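(* There is a constant $C>0$, independent of the mesh size $h$, of the location of $\Gamma$ relative to the mesh, and of $\beta^\pm$, such that for $j=0,1$ and all $p\in\mathbb{Q}_1$, $$|\mathcal{C}_T(p)|_{H^j(T_2)}\le C|p|_{H^j(T_2)},\qquad |\mathcal{C}_T^{-1}(p)|_{H^j(T_2)}\le C\frac{\beta^+}{\beta^-}|p|_{H^j(T_2)},$$ for every interface element $T$ of one of the following types: Type I; Type II; Type III, if $|A_4D_4|\ge\frac12|A_4A_3|$ or $|A_2D_1|\ge\frac12|A_2A_1|$ or $|A_6D_2|\ge\frac12|A_6A_5|$ or $|A_8D_3|\ge\frac12|A_8A_7|$; Type IV; Type V.
   Context: Setting and mesh: $\Omega\subset\mathbb{R}^3$ is an open cuboid domain, separated into two subdomains $\Omega^-$ and $\Omega^+$ by a closed $C^2$ surface $\Gamma\subset\Omega$ (the interface). The coefficients are constants $\beta^\pm>0$ on $\Omega^\pm$, with the convention that $\beta^+$ denotes the larger and $\beta^-$ the smaller coefficient. $\kappa$ is the maximal (principal) curvature of $\Gamma$, and $r_\Gamma$ (the reach) is the largest $r$ such that the segments $N_X(r)$, $X\in\Gamma$, of length $2r$, centered at $X$ and perpendicular to $\Gamma$, are pairwise disjoint. $\mathcal{T}_h$ is a Cartesian mesh of $\Omega$ consisting of cuboids, where $h$ denotes the maximum length of all the cuboids. An element is an interface element if its vertices do not all lie on the same side of $\Gamma$. Standing assumptions: $h<r_\Gamma/(3\sqrt3)$; $h\kappa\le 0.0288$; $\Gamma$ cannot intersect a mesh edge at more than one point; $\Gamma$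 cannot intersect a mesh face at more than two edges. Vertices and types: the vertices of the cuboid $T$ are labelled $A_1,\dots,A_8$ so that, up to rotation/reflection, with $e_1,e_2,e_3$ the edge directions and $\ell_1,\ell_2,\ell_3$ the corresponding edge lengths of $T$, $A_2=A_1+\ell_1e_1$, $A_3=A_1+\ell_2e_2$, $A_4=A_1+\ell_1e_1+\ell_2e_2$, and $A_{k+4}=A_k+\ell_3e_3$ for $k=1,\dots,4$. $\Gamma$ cuts $T$ into two subelements: $T_1\ni A_1$ and $T_2\ni A_8$. Up to symmetry there are five types. Type I: three intersection points of $\Gamma$ with edges of $T$, $A_1$ being the only vertex in $T_1$. Type II: four intersection points, $T_1$ containing exactly $A_1$ and one adjacent vertex. Type III: four intersection points on four parallel edges, $D_1\in A_1A_2$, $D_2\in A_5A_6$, $D_3\in A_7A_8$, $D_4\in A_3A_4$, so that $T_1\ni A_1,A_3,A_5,A_7$ and $T_2\ni A_2,A_4,A_6,A_8$. Type IV: five intersection points, $T_1$ containing exactly three vertices (a vertex and two of its neighbours), including $A_1$. Type V: six intersection points, each of $T_1,T_2$ containing four vertices forming a vertex together with its three neighbours. Approximate plane and extension operator: fix a triangle whose vertices are three of the intersection points of $\Gamma$ with edges of $T$ and whose maximal angle is at most $135^\circ$ (such a triangle always exists; for Type III take $\triangle D_1D_4D_3$). $\tau_T$ is its plane, $\bar{\mathbf{n}}$ a unit normal to $\tau_T$, $F_T$ the centroid of the triangle, $L(X)=(X-F_T)\cdot\bar{\mathbf{n}}$. With $\mathbb{Q}_1=\mathrm{Span}\{1,x,y,z,xy,xz,yz,xyz\}$,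 the operator $\mathcal{C}_T:\mathbb{Q}_1\to\mathbb{Q}_1$ and its inverse are $$\mathcal{C}_T(p)=p+\left(\tfrac{\beta^-}{\beta^+}-1\right)(\nabla p(F_T)\cdot\bar{\mathbf{n}})L,\qquad \mathcal{C}_T^{-1}(p)=p+\left(\tfrac{\beta^+}{\beta^-}-1\right)(\nabla p(F_T)\cdot\bar{\mathbf{n}})L.$$ $|\cdot|_{H^0}$ is the $L^2$ norm.
   Formalization: The constant C may depend on a bound σ for the ratio of edge lengths within each cuboid of the mesh (shape regularity); without such a bound the L² estimate (j=0) fails on thin ε×1×1 cuboids with a corner cut off. *)

theory Defs
  imports "HOL-Analysis.Analysis"
begin

type_synonym point = "real^3"

definition grad :: "(point \<Rightarrow> real) \<Rightarrow> point \<Rightarrow> point" where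
  "grad f x = (\<chi> i. frechet_derivative f (at x) (axis i 1))"

section \<open>Closed surfaces of class C2, principal curvature, reach\<close>

definition C2_on :: "point set \<Rightarrow> (point \<Rightarrow> real) \<Rightarrow> bool" where
  "C2_on U f \<longleftrightarrow>
     (\<exists>H :: point \<Rightarrow> real^3^3. continuous_on U H \<and>
        (\<forall>x\<in>U. (f has_derivative (\<lambda>v. grad f x \<bullet> v)) (at x) \<and>
               (grad f has_derivative (\<lambda>v. H x *v v)) (at x)))"

text \<open>A local description of \<open>\<Gamma>\<close> near \<open>X \<in> \<Gamma>\<close> as a regular level set of a C2 function.\<close>
definition local_C2_equation ::
    "point set \<Rightarrow> point \<Rightarrow> point set \<Rightarrow> (point \<Rightarrow> real) \<Rightarrow> bool" where
  "local_C2_equation \<Gamma> X U f \<longleftrightarrow>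
     open U \<and> X \<in> U \<and> X \<in> \<Gamma> \<and> C2_on U f \<and> (\<forall>x\<in>U. grad f x \<noteq> 0) \<and>
     \<Gamma> \<inter> U = {x \<in> U. f x = 0}"

definition closed_C2_surface :: "point set \<Rightarrow> bool" where
  "closed_C2_surface \<Gamma> \<longleftrightarrow>
     compact \<Gamma> \<and> connected \<Gamma> \<and> \<Gamma> \<noteq> {} \<and> (\<forall>X\<in>\<Gamma>. \<exists>U f. local_C2_equation \<Gamma> X U f)"

text \<open>Replacing \<open>f\<close> by \<open>-f\<close> reverses the normal, so both unit normals qualify at each point.
  (\<open>sgn v\<close> is \<open>v\<close> divided by its norm.)\<close>
definition unit_normal :: "point set \<Rightarrow> point \<Rightarrow> point \<Rightarrow> bool" where
  "unit_normal \<Gamma> X n \<longleftrightarrow> (\<exists>U f. local_C2_equation \<Gamma> X U f \<and> n = sgn (grad f X))"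

text \<open>Principal curvatures are the eigenvalues of the differential of the unit normal field on
  the tangent plane; their sign depends on the orientation, so both signs occur here and
  \<open>max_curvature\<close> takes absolute values.\<close>
definition principal_curvature :: "point set \<Rightarrow> point \<Rightarrow> real \<Rightarrow> bool" where
  "principal_curvature \<Gamma> X k \<longleftrightarrow>
     (\<exists>U f v. local_C2_equation \<Gamma> X U f \<and> v \<noteq> 0 \<and> v \<bullet> grad f X = 0 \<and>
        frechet_derivative (\<lambda>x. sgn (grad f x)) (at X) v = k *\<^sub>R v)"

definition max_curvature :: "point set \<Rightarrow> real" where
  "max_curvature \<Gamma> = Sup {\<bar>k\<bar> |k. \<exists>X\<in>\<Gamma>. principal_curvature \<Gamma> X k}"

definition normal_segment :: "point set \<Rightarrow> point \<Rightarrow> real \<Rightarrow> point set" where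
  "normal_segment \<Gamma> X r = {X + t *\<^sub>R n |t n. \<bar>t\<bar> \<le> r \<and> unit_normal \<Gamma> X n}"

text \<open>A supremum, since the largest value need not be attained: for a sphere the closed
  segments whose half-length is the radius all meet in the centre.\<close>
definition surface_reach :: "point set \<Rightarrow> real" where
  "surface_reach \<Gamma> = Sup {r. 0 \<le> r \<and> disjoint_family_on (\<lambda>X. normal_segment \<Gamma> X r) \<Gamma>}"

section \<open>Interface and mesh\<close>

text \<open>\<open>\<Omega>m\<close> and \<open>\<Omega>p\<close> are the two subdomains; that \<open>\<Gamma>\<close> separates them includes that it is their
  common boundary inside \<open>\<Omega>\<close>.\<close>
definition separates :: "point set \<Rightarrow> point set \<Rightarrow> point set \<Rightarrow> point set \<Rightarrow> bool" where
  "separates \<Gamma> \<Omega> \<Omega>m \<Omega>p \<longleftrightarrow>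
     \<Gamma> \<subseteq> \<Omega> \<and> \<Omega> - \<Gamma> = \<Omega>m \<union> \<Omega>p \<and> \<Omega>m \<inter> \<Omega>p = {} \<and>
     open \<Omega>m \<and> connected \<Omega>m \<and> \<Omega>m \<noteq> {} \<and>
     open \<Omega>p \<and> connected \<Omega>p \<and> \<Omega>p \<noteq> {} \<and>
     \<Gamma> \<subseteq> closure \<Omega>m \<and> \<Gamma> \<subseteq> closure \<Omega>p"

text \<open>\<open>N i\<close> is the set of grid coordinates in direction \<open>i\<close>; the cells are the products of
  intervals between consecutive grid coordinates.\<close>
definition cartesian_mesh :: "point \<Rightarrow> point \<Rightarrow> point set set \<Rightarrow> bool" where
  "cartesian_mesh a b \<T> \<longleftrightarrow>
     (\<exists>N :: 3 \<Rightarrow> real set.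
        (\<forall>i. finite (N i) \<and> {a $ i, b $ i} \<subseteq> N i \<and> N i \<subseteq> {a $ i..b $ i}) \<and>
        \<T> = {cbox u v |u v. \<forall>i. u $ i \<in> N i \<and> v $ i \<in> N i \<and> u $ i < v $ i \<and>
                                  N i \<inter> {u $ i<..<v $ i} = {}})"

definition edge_lengths :: "point set \<Rightarrow> real set" where
  "edge_lengths T = {dist P Q |P Q. closed_segment P Q edge_of T}"

definition mesh_size :: "point set set \<Rightarrow> real" where
  "mesh_size \<T> = Sup (\<Union>T\<in>\<T>. edge_lengths T)"

text \<open>The constant of the extension estimate depends on \<open>\<sigma>\<close> only: on anisotropic cuboids
  (\<open>\<epsilon> * 1 * 1\<close> with a corner cut off) no constant uniform in the aspect ratio exists.\<close>
definition shape_regular :: "real \<Rightarrow> point set set \<Rightarrow> bool" where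
  "shape_regular \<sigma> \<T> \<longleftrightarrow> (\<forall>T\<in>\<T>. \<forall>l\<in>edge_lengths T. \<forall>m\<in>edge_lengths T. l \<le> \<sigma> * m)"

definition interface_mesh ::
    "point \<Rightarrow> point \<Rightarrow> point set \<Rightarrow> point set \<Rightarrow> point set \<Rightarrow> point set set \<Rightarrow> bool" where
  "interface_mesh a b \<Gamma> \<Omega>m \<Omega>p \<T> \<longleftrightarrow>
     (\<forall>i. a $ i < b $ i) \<and>
     closed_C2_surface \<Gamma> \<and> separates \<Gamma> (box a b) \<Omega>m \<Omega>p \<and>
     cartesian_mesh a b \<T> \<and>
     mesh_size \<T> < surface_reach \<Gamma> / (3 * sqrt 3) \<and>
     mesh_size \<T> * max_curvature \<Gamma> \<le> 0.0288 \<and>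
     (\<forall>T\<in>\<T>. \<forall>e. e edge_of T \<longrightarrow> (\<forall>X\<in>\<Gamma> \<inter> e. \<forall>Y\<in>\<Gamma> \<inter> e. X = Y)) \<and>
     (\<forall>T\<in>\<T>. \<forall>f. f facet_of T \<longrightarrow> card {e. e edge_of f \<and> \<Gamma> \<inter> e \<noteq> {}} \<le> 2)"

text \<open>The side of \<open>\<Gamma>\<close> belonging to the subdomain \<open>D\<close>, within the closure of \<open>\<Omega>\<close>. The closure is
  taken so that vertices of the mesh on the boundary of \<open>\<Omega>\<close> also lie on a side.\<close>
definition side :: "point set \<Rightarrow> point set \<Rightarrow> point set" where
  "side \<Gamma> D = closure D - \<Gamma>"

definition interface_element :: "point set \<Rightarrow> point set \<Rightarrow> point set \<Rightarrow> point set \<Rightarrow> bool" where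
  "interface_element \<Gamma> \<Omega>m \<Omega>p T \<longleftrightarrow>
     \<not> {X. X extreme_point_of T} \<subseteq> side \<Gamma> \<Omega>m \<and> \<not> {X. X extreme_point_of T} \<subseteq> side \<Gamma> \<Omega>p"

definition edge_points :: "point set \<Rightarrow> point set \<Rightarrow> point set" where
  "edge_points \<Gamma> T = \<Gamma> \<inter> \<Union>{e. e edge_of T}"

section \<open>Labelled vertices and element types\<close>

text \<open>The edge vectors \<open>axis i r\<close>, \<open>axis j s\<close>, \<open>axis k t\<close> may have either sign, and the axes may
  come in any order, so all rotated and reflected labellings are covered.\<close>
definition vertex_labelling :: "point set \<Rightarrow> (nat \<Rightarrow> point) \<Rightarrow> bool" where
  "vertex_labelling T A \<longleftrightarrow>
     (\<exists>i j k r s t. distinct [i, j, k] \<and> r \<noteq> 0 \<and> s \<noteq> 0 \<and> t \<noteq> 0 \<and>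
        A 2 = A 1 + axis i r \<and> A 3 = A 1 + axis j s \<and> A 4 = A 1 + axis i r + axis j s \<and>
        (\<forall>m\<in>{1..4}. A (m + 4) = A m + axis k t) \<and>
        T = convex hull (A ` {1..8}))"

definition neighbours :: "point set \<Rightarrow> (nat \<Rightarrow> point) \<Rightarrow> nat \<Rightarrow> nat set" where
  "neighbours T A c = {k \<in> {1..8}. closed_segment (A c) (A k) edge_of T}"

text \<open>\<open>V\<close> is the set of labels of the vertices in \<open>T1\<close>; all other vertices lie in \<open>T2\<close>.\<close>
definition vertex_split ::
    "(nat \<Rightarrow> point) \<Rightarrow> point set \<Rightarrow> point set \<Rightarrow> nat set \<Rightarrow> bool" where
  "vertex_split A T1 T2 V \<longleftrightarrow>
     V \<subseteq> {1..8} \<and> {k \<in> {1..8}. A k \<in> T1} = V \<and> {k \<in> {1..8}. A k \<in> T2} = {1..8} - V"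

definition type_I ::
    "point set \<Rightarrow> point set \<Rightarrow> (nat \<Rightarrow> point) \<Rightarrow> point set \<Rightarrow> point set \<Rightarrow> bool" where
  "type_I \<Gamma> T A T1 T2 \<longleftrightarrow> card (edge_points \<Gamma> T) = 3 \<and> vertex_split A T1 T2 {1}"

definition type_II ::
    "point set \<Rightarrow> point set \<Rightarrow> (nat \<Rightarrow> point) \<Rightarrow> point set \<Rightarrow> point set \<Rightarrow> bool" where
  "type_II \<Gamma> T A T1 T2 \<longleftrightarrow>
     card (edge_points \<Gamma> T) = 4 \<and> (\<exists>m\<in>neighbours T A 1. vertex_split A T1 T2 {1, m})"

definition type_III ::
    "point set \<Rightarrow> point set \<Rightarrow> (nat \<Rightarrow> point) \<Rightarrow> point set \<Rightarrow> point set \<Rightarrow>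
      point \<Rightarrow> point \<Rightarrow> point \<Rightarrow> point \<Rightarrow> bool" where
  "type_III \<Gamma> T A T1 T2 D1 D2 D3 D4 \<longleftrightarrow>
     card (edge_points \<Gamma> T) = 4 \<and> edge_points \<Gamma> T = {D1, D2, D3, D4} \<and>
     D1 \<in> closed_segment (A 1) (A 2) \<and> D2 \<in> closed_segment (A 5) (A 6) \<and>
     D3 \<in> closed_segment (A 7) (A 8) \<and> D4 \<in> closed_segment (A 3) (A 4) \<and>
     vertex_split A T1 T2 {1, 3, 5, 7}"

definition type_IV ::
    "point set \<Rightarrow> point set \<Rightarrow> (nat \<Rightarrow> point) \<Rightarrow> point set \<Rightarrow> point set \<Rightarrow> bool" where
  "type_IV \<Gamma> T A T1 T2 \<longleftrightarrow>
     card (edge_points \<Gamma> T) = 5 \<and>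
     (\<exists>c\<in>{1..8}. \<exists>m\<in>neighbours T A c. \<exists>m'\<in>neighbours T A c. m \<noteq> m' \<and> 1 \<in> {c, m, m'} \<and>
        vertex_split A T1 T2 {c, m, m'})"

definition type_V ::
    "point set \<Rightarrow> point set \<Rightarrow> (nat \<Rightarrow> point) \<Rightarrow> point set \<Rightarrow> point set \<Rightarrow> bool" where
  "type_V \<Gamma> T A T1 T2 \<longleftrightarrow>
     card (edge_points \<Gamma> T) = 6 \<and>
     (\<exists>c\<in>{1..8}. \<exists>d\<in>{1..8}.
        {1..8} - insert c (neighbours T A c) = insert d (neighbours T A d) \<and>
        vertex_split A T1 T2 (insert c (neighbours T A c)))"

section \<open>Approximate plane\<close>

definition vertex_angle :: "point \<Rightarrow> point \<Rightarrow> point \<Rightarrow> real" where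
  "vertex_angle P Q R = arccos (((Q - P) \<bullet> (R - P)) / (norm (Q - P) * norm (R - P)))"

text \<open>The angle at \<open>P\<close> is \<open>vertex_angle P Q R\<close>, and 135 degrees is \<open>3\<pi>/4\<close>. Collinear
  triples are excluded, one of their angles being \<open>\<pi>\<close>.\<close>
definition triangle_le_135 :: "point \<Rightarrow> point \<Rightarrow> point \<Rightarrow> bool" where
  "triangle_le_135 P Q R \<longleftrightarrow>
     distinct [P, Q, R] \<and> vertex_angle P Q R \<le> 3 * pi / 4 \<and>
     vertex_angle Q R P \<le> 3 * pi / 4 \<and> vertex_angle R P Q \<le> 3 * pi / 4"

text \<open>The elements covered by the estimate, together with their chosen triangle \<open>P Q R\<close>. For
  Type III the triangle is prescribed and is never degenerate, so no angle condition is imposed.\<close>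
definition covered_element ::
    "point set \<Rightarrow> point set \<Rightarrow> (nat \<Rightarrow> point) \<Rightarrow> point set \<Rightarrow> point set \<Rightarrow>
      point \<Rightarrow> point \<Rightarrow> point \<Rightarrow> bool" where
  "covered_element \<Gamma> T A T1 T2 P Q R \<longleftrightarrow>
     ((type_I \<Gamma> T A T1 T2 \<or> type_II \<Gamma> T A T1 T2 \<or> type_IV \<Gamma> T A T1 T2 \<or> type_V \<Gamma> T A T1 T2) \<and>
      {P, Q, R} \<subseteq> edge_points \<Gamma> T \<and> triangle_le_135 P Q R) \<or>
     (\<exists>D1 D2 D3 D4. type_III \<Gamma> T A T1 T2 D1 D2 D3 D4 \<and>
        (dist (A 4) D4 \<ge> 1/2 * dist (A 4) (A 3) \<or> dist (A 2) D1 \<ge> 1/2 * dist (A 2) (A 1) \<or>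
         dist (A 6) D2 \<ge> 1/2 * dist (A 6) (A 5) \<or> dist (A 8) D3 \<ge> 1/2 * dist (A 8) (A 7)) \<and>
        P = D1 \<and> Q = D4 \<and> R = D3)"

definition centroid :: "point \<Rightarrow> point \<Rightarrow> point \<Rightarrow> point" where
  "centroid P Q R = (1/3) *\<^sub>R (P + Q + R)"

definition unit_normal_to_plane :: "point \<Rightarrow> point \<Rightarrow> point \<Rightarrow> point \<Rightarrow> bool" where
  "unit_normal_to_plane P Q R n \<longleftrightarrow> norm n = 1 \<and> n \<bullet> (Q - P) = 0 \<and> n \<bullet> (R - P) = 0"

section \<open>Trilinear polynomials, extension operator, seminorms\<close>

definition Q1 :: "(point \<Rightarrow> real) set" where
  "Q1 = {p. \<exists>c :: nat \<Rightarrow> real. p = (\<lambda>X.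
      c 0 + c 1 * X $ 1 + c 2 * X $ 2 + c 3 * X $ 3 + c 4 * (X $ 1 * X $ 2)
      + c 5 * (X $ 1 * X $ 3) + c 6 * (X $ 2 * X $ 3) + c 7 * (X $ 1 * X $ 2 * X $ 3))}"

definition ext_op ::
    "real \<Rightarrow> real \<Rightarrow> point \<Rightarrow> point \<Rightarrow> (point \<Rightarrow> real) \<Rightarrow> point \<Rightarrow> real" where
  "ext_op \<beta>m \<beta>p F n p = (\<lambda>X. p X + (\<beta>m / \<beta>p - 1) * (grad p F \<bullet> n) * ((X - F) \<bullet> n))"

definition ext_op_inv ::
    "real \<Rightarrow> real \<Rightarrow> point \<Rightarrow> point \<Rightarrow> (point \<Rightarrow> real) \<Rightarrow> point \<Rightarrow> real" where
  "ext_op_inv \<beta>m \<beta>p F n p = (\<lambda>X. p X + (\<beta>p / \<beta>m - 1) * (grad p F \<bullet> n) * ((X - F) \<bullet> n))"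

lemma Q1_differentiable: "p \<in> Q1 \<Longrightarrow> p differentiable (at F)"
proof -
  have "(\<lambda>X :: point. X $ i) differentiable (at F)" for i
    by (rule bounded_linear_imp_differentiable) (rule bounded_linear_vec_nth)
  then show "p \<in> Q1 \<Longrightarrow> p differentiable (at F)"
    unfolding Q1_def
    by (auto intro!: differentiable_add differentiable_mult)
qed

lemma ext_op_inverse:
  assumes "p \<in> Q1" "\<beta>m \<noteq> 0" "\<beta>p \<noteq> 0" "norm n = 1"
  shows "ext_op_inv \<beta>m \<beta>p F n (ext_op \<beta>m \<beta>p F n p) = p"
    and "ext_op \<beta>m \<beta>p F n (ext_op_inv \<beta>m \<beta>p F n p) = p"
proof -
  have g: "grad (\<lambda>X. p X + c * d * ((X - F) \<bullet> n)) F = grad p F + (c * d) *\<^sub>R n" for c d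
  proof -
    have "(p has_derivative frechet_derivative p (at F)) (at F)"
      using Q1_differentiable[OF assms(1)] by (simp add: frechet_derivative_works)
    then have "((\<lambda>X. p X + c * d * ((X - F) \<bullet> n)) has_derivative
        (\<lambda>v. frechet_derivative p (at F) v + c * d * (v \<bullet> n))) (at F)"
      by (auto intro!: derivative_eq_intros)
    then show ?thesis
      by (simp add: grad_def frechet_derivative_at[symmetric] vec_eq_iff inner_axis')
  qed
  have n: "n \<bullet> n = 1" using assms(4) by (simp add: norm_eq_1)
  show "ext_op_inv \<beta>m \<beta>p F n (ext_op \<beta>m \<beta>p F n p) = p"
    and "ext_op \<beta>m \<beta>p F n (ext_op_inv \<beta>m \<beta>p F n p) = p"
    unfolding ext_op_def ext_op_inv_def g
    using assms(2,3) n by (auto simp: fun_eq_iff inner_add_left field_simps)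
qed

primrec H_seminorm_sq :: "nat \<Rightarrow> point set \<Rightarrow> (point \<Rightarrow> real) \<Rightarrow> real" where
  "H_seminorm_sq 0 S p = (LINT X:S|lborel. (p X)\<^sup>2)"
| "H_seminorm_sq (Suc j) S p = (\<Sum>i\<in>UNIV. H_seminorm_sq j S (\<lambda>X. grad p X $ i))"

definition H_seminorm :: "nat \<Rightarrow> point set \<Rightarrow> (point \<Rightarrow> real) \<Rightarrow> real" where
  "H_seminorm j S p = sqrt (H_seminorm_sq j S p)"

end

theory Submission
  imports Defs
begin

text \<open>Each operator adds to \<open>p\<close> a multiple of \<open>(grad p F \<bullet> n) * ((X - F) \<bullet> n)\<close>, and the factor is at most
\<open>1\<close> for \<open>ext_op\<close> and at most \<open>\<beta>p / \<beta>m\<close> for \<open>ext_op_inv\<close> in absolute value.  So the estimate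
reduces to bounding \<open>\<bar>grad p F\<bar>\<close>, at a point \<open>F\<close> of the cell \<open>T\<close>, by the seminorm of \<open>p\<close> over the
part \<open>T2\<close> of the cell, which is an inverse inequality.  It holds with a constant independent of
everything but the shape of \<open>T\<close> once \<open>T2\<close> contains a ball whose radius is a fixed fraction of the
shortest edge of \<open>T\<close>.

The inverse inequality (\<open>extension_bound_sq\<close>) is elementary.  A trilinear function is affine along
each coordinate direction, so its value at any point of the cell is a combination, with bounded
weights, of its values at eight points \<open>\<alpha> + w\<close>, where \<open>\<alpha>\<close> may be any point of a small cube and the
\<open>w\<close> are fixed shifts; integrating over \<open>\<alpha>\<close> gives the bound.  Partial derivatives of trilinear
functions are differences of translates and again affine along each coordinate direction, so the
same bound serves both seminorms.

The ball is found by means of the reach.  If \<open>r\<close> is admissible in the definition of the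
reach, the two open balls of radius \<open>r\<close> tangent to \<open>\<Gamma>\<close> at any of its points miss \<open>\<Gamma>\<close>: otherwise the
centre would also lie on the normal segment of its nearest point (\<open>tangent_ball_avoids_surface\<close>).
One of the two balls lies on each side of \<open>\<Gamma>\<close> (\<open>tangent_balls_opposite_sides\<close>).  At the scale of
a cell these balls are nearly half spaces, since \<open>r\<close> is more than five times the longest edge.

Now suppose that a vertex \<open>Z\<close> of the cell and the first halves of its three edges lie on the side in
question, except possibly for points of \<open>\<Gamma>\<close> (\<open>ball_at_vertex\<close>).  Either no point of \<open>\<Gamma>\<close> is close to \<open>Z\<close>, and then a
neighbourhood of \<open>Z\<close> in the cell belongs to this side; or some \<open>X \<in> \<Gamma>\<close> is close to \<open>Z\<close>.  In the
latter case the three half edges avoid the ball tangent at \<open>X\<close> from the other side, so the normal at \<open>X\<close>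
nearly lies in the octant spanned by the three edges, and the ball tangent from this side contains
a large portion of the cell.

Such a vertex exists for all covered elements (\<open>covered_element_free_vertex\<close>).  For Types I, II, IV
and V some vertex of \<open>T2\<close> has all its three neighbours in \<open>T2\<close>, and since \<open>\<Gamma>\<close> meets an edge at most
once, an edge with both ends on one side stays there, except for at most one point of \<open>\<Gamma>\<close>.  For Type III only one edge at each vertex of
\<open>T2\<close> crosses \<open>\<Gamma>\<close>, and the requirement on the positions of \<open>D1, \<dots>, D4\<close> says that for one of these
vertices at least half of that edge lies in \<open>T2\<close>.\<close>

section \<open>Inverse estimates for trilinear functions\<close>

text \<open>A coordinate-free substitute for \<open>Q1\<close>: unlike the description by coefficients, this property is
seen at once to be inherited by partial derivatives.\<close>
definition multiaffine :: "(point \<Rightarrow> real) \<Rightarrow> bool" where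
  "multiaffine p \<longleftrightarrow> continuous_on UNIV p \<and>
     (\<forall>i X t. p (X + axis i t) = p X + t * (p (X + axis i 1) - p X))"

lemma Q1_multiaffine: assumes "p \<in> Q1" shows "multiaffine p"
proof -
  obtain c :: "nat \<Rightarrow> real" where p: "p = (\<lambda>X.
      c 0 + c 1 * X $ 1 + c 2 * X $ 2 + c 3 * X $ 3 + c 4 * (X $ 1 * X $ 2)
      + c 5 * (X $ 1 * X $ 3) + c 6 * (X $ 2 * X $ 3) + c 7 * (X $ 1 * X $ 2 * X $ 3))"
    using assms unfolding Q1_def by blast
  have "p (X + axis i t) = p X + t * (p (X + axis i 1) - p X)" for i X t
  proof -
    consider "i = 1" | "i = 2" | "i = 3" using exhaust_3 by blast
    then show ?thesis
    proof cases
      case 1 then show ?thesis unfolding p by (simp add: axis_def) (simp only: algebra_simps)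
    next
      case 2 then show ?thesis unfolding p by (simp add: axis_def) (simp only: algebra_simps)
    next
      case 3 then show ?thesis unfolding p by (simp add: axis_def) (simp only: algebra_simps)
    qed
  qed
  moreover have "continuous_on UNIV p"
    unfolding p by (intro continuous_intros)
  ultimately show ?thesis unfolding multiaffine_def by blast
qed

lemma multiaffine_continuous_on: "multiaffine p \<Longrightarrow> continuous_on A p"
  using continuous_on_subset by (auto simp: multiaffine_def)

text \<open>By \<open>grad_multiaffine\<close> below, these differences are the partial derivatives.\<close>
lemma multiaffine_difference:
  assumes "multiaffine p"
  shows "multiaffine (\<lambda>X. p (X + axis i 1) - p X)"
proof -
  let ?q = "\<lambda>X. p (X + axis i 1) - p X"
  have p: "p (X + axis j t) = p X + t * (p (X + axis j 1) - p X)" for X j t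
    using assms unfolding multiaffine_def by blast
  have pc: "continuous_on UNIV p" using assms by (simp add: multiaffine_def)
  have "continuous_on UNIV (\<lambda>X. p (X + axis i 1))"
    by (rule continuous_on_compose2[OF pc]) (intro continuous_intros, simp)
  then have "continuous_on UNIV ?q" using pc by (rule continuous_on_diff)
  moreover have "?q (X + axis j t) = ?q X + t * (?q (X + axis j 1) - ?q X)" for X j t
  proof -
    have e: "X + axis j s + axis i 1 = (X + axis i 1) + axis j s" for s by simp
    show ?thesis
      unfolding e p[of "X + axis i 1" j t] p[of X j t] by (simp only: algebra_simps)
  qed
  ultimately show ?thesis unfolding multiaffine_def by blast
qed

lemma grad_multiaffine:
  assumes "multiaffine p" "p differentiable (at X)"
  shows "grad p X $ i = p (X + axis i 1) - p X"
proof -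
  let ?D = "frechet_derivative p (at X)"
  have "(p has_derivative ?D) (at X)"
    using assms(2) by (simp add: frechet_derivative_works)
  then have "((\<lambda>t. p (X + t *\<^sub>R axis i 1)) has_derivative (\<lambda>t. ?D (t *\<^sub>R axis i 1))) (at 0)"
    by (auto intro!: derivative_eq_intros has_derivative_compose[of "\<lambda>t. X + t *\<^sub>R axis i 1" _ 0 _ p])
  moreover have "p (X + t *\<^sub>R axis i 1) = p X + t * (p (X + axis i 1) - p X)" for t
  proof -
    have "t *\<^sub>R axis i 1 = (axis i t :: point)" by (simp add: vec_eq_iff axis_def)
    then show ?thesis using assms(1) unfolding multiaffine_def by metis
  qed
  moreover have "((\<lambda>t. p X + t * (p (X + axis i 1) - p X)) has_derivative
      (\<lambda>t. t * (p (X + axis i 1) - p X))) (at 0)"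
    by (auto intro!: derivative_eq_intros)
  ultimately have "(\<lambda>t. ?D (t *\<^sub>R axis i 1)) = (\<lambda>t. t * (p (X + axis i 1) - p X))"
    by (simp add: has_derivative_unique)
  from fun_cong[OF this, of 1] show ?thesis by (simp add: grad_def)
qed

lemma continuous_set_integrable:
  fixes g :: "point \<Rightarrow> real"
  assumes "continuous_on UNIV g" "S \<in> sets borel" "S \<subseteq> cbox u v"
  shows "set_integrable lborel S g"
proof -
  have "set_integrable lborel (cbox u v) g"
    unfolding set_integrable_def
    using borel_integrable_compact[of "cbox u v" g] assms(1)
    by (auto simp: continuous_on_subset indicator_scaleR_eq_if)
  then show ?thesis by (rule set_integrable_subset) (use assms in auto)
qed

text \<open>Translation invariance of the Lebesgue measure, in the form that compares the shifted integrals of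
the interpolation argument with the single integral over \<open>S\<close>.\<close>
lemma integral_translate_le:
  fixes g :: "point \<Rightarrow> real"
  assumes "continuous_on UNIV g" "S \<in> sets borel" "S \<subseteq> cbox u v" "\<And>X. 0 \<le> g X"
    and "Q \<in> sets borel" "\<And>X. X \<in> Q \<Longrightarrow> X + w \<in> S"
  shows "(LINT X:Q|lborel. g (X + w)) \<le> (LINT X:S|lborel. g X)"
proof -
  have gm: "g \<in> borel_measurable borel" using assms(1) by (rule borel_measurable_continuous_onI)
  define f where "f X = indicator Q (X - w) * g X" for X
  have [measurable]: "f \<in> borel_measurable borel"
    unfolding f_def using gm assms(5) by measurable
  have eq: "(LINT X:Q|lborel. g (X + w)) = (LINT X|lborel. f (w + X))"
    unfolding set_lebesgue_integral_def f_def by (simp add: add.commute)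
  also have "\<dots> = (LINT X|distr lborel borel ((+) w). f X)"
    by (subst integral_distr) auto
  also have "\<dots> = (LINT X|lborel. f X)" by (simp add: lborel_distr_plus)
  also have "\<dots> \<le> (LINT X:S|lborel. g X)"
    unfolding set_lebesgue_integral_def
  proof (rule integral_mono')
    show "integrable lborel (\<lambda>X. indicator S X *\<^sub>R g X)"
      using continuous_set_integrable[OF assms(1-3)] by (simp add: set_integrable_def)
    show "f X \<le> indicator S X *\<^sub>R g X" for X
      using assms(4)[of X] assms(6)[of "X - w"] by (auto simp: f_def indicator_def)
    show "0 \<le> indicator S X *\<^sub>R g X" for X using assms(4) by simp
  qed
  finally show ?thesis .
qed

lemma norm_sq_le_of_components:
  fixes x :: point
  assumes "\<And>i. \<bar>x $ i\<bar> \<le> b"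
  shows "(norm x)\<^sup>2 \<le> 3 * b\<^sup>2"
proof -
  have "(norm x)\<^sup>2 = (\<Sum>i\<in>UNIV. (x $ i)\<^sup>2)"
    by (simp add: norm_vec_def L2_set_def sum_nonneg)
  also have "\<dots> \<le> (\<Sum>i\<in>(UNIV::3 set). b\<^sup>2)"
    by (intro sum_mono) (metis assms abs_ge_zero power2_abs power_mono)
  finally show ?thesis by simp
qed

text \<open>Along a line in direction \<open>axis i\<close> the function is affine, hence equal to the interpolant of its
values at \<open>X\<close> and \<open>X + axis i h\<close>; the weights at distance \<open>d\<close> are \<open>1 - d / h\<close> and \<open>d / h\<close>.\<close>
lemma multiaffine_interpolate_sq:
  assumes "multiaffine p" "0 < h" "\<bar>d\<bar> \<le> K * h"
  shows "(p (X + axis i d))\<^sup>2 \<le> 2 * (K + 1)\<^sup>2 * ((p X)\<^sup>2 + (p (X + axis i h))\<^sup>2)"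
proof -
  define t where "t = d / h"
  have d: "d = t * h" and t: "\<bar>t\<bar> \<le> K"
    using assms(2,3) by (auto simp: t_def field_simps abs_divide)
  have K: "0 \<le> K" using t by linarith
  have f: "p (X + axis i d) = p X + d * (p (X + axis i 1) - p X)"
       "p (X + axis i h) = p X + h * (p (X + axis i 1) - p X)"
    using assms(1) unfolding multiaffine_def by blast+
  have e: "p (X + axis i d) = (1 - t) * p X + t * p (X + axis i h)"
    unfolding f by (simp only: d) (simp only: algebra_simps)
  have sq: "(a + b)\<^sup>2 \<le> 2 * (a\<^sup>2 + b\<^sup>2)" for a b :: real
    using sum_squares_bound[of a b] by (simp add: power2_sum)
  have "(1 - t)\<^sup>2 \<le> (K + 1)\<^sup>2" "t\<^sup>2 \<le> (K + 1)\<^sup>2"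
    using t K by (auto intro!: power2_le_iff_abs_le[THEN iffD2])
  then have "(1 - t)\<^sup>2 * (p X)\<^sup>2 + t\<^sup>2 * (p (X + axis i h))\<^sup>2
      \<le> (K + 1)\<^sup>2 * (p X)\<^sup>2 + (K + 1)\<^sup>2 * (p (X + axis i h))\<^sup>2"
    by (intro add_mono mult_right_mono) auto
  then show ?thesis
    using sq[of "(1 - t) * p X" "t * p (X + axis i h)"] unfolding e power_mult_distrib
    by argo
qed

text \<open>Three one-dimensional interpolations, one per coordinate, each at the cost of a factor
\<open>2 * (K + 1)\<^sup>2\<close>.\<close>
lemma multiaffine_corner_sum:
  assumes "multiaffine p" "0 < h" "\<And>i. \<bar>x $ i - X $ i\<bar> \<le> K * h"
  shows "(p x)\<^sup>2 \<le> 8 * (K + 1) ^ 6 *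
    (\<Sum>(a, b, c)\<in>{0, h} \<times> {0, h} \<times> {0, h}. (p (X + (axis 1 a + axis 2 b + axis 3 c)))\<^sup>2)"
proof -
  define C where "C = 2 * (K + 1)\<^sup>2"
  have C: "0 \<le> C" by (simp add: C_def)
  have step: "(p (Y + axis i (x $ i - X $ i)))\<^sup>2 \<le> C * (\<Sum>a\<in>{0, h}. (p (Y + axis i a))\<^sup>2)" for Y i
    using multiaffine_interpolate_sq[OF assms(1,2) assms(3), of Y i i] assms(2)
    by (simp add: C_def axis_eq_0_iff[THEN iffD2])
  have x: "x = X + axis 1 (x $ 1 - X $ 1) + axis 2 (x $ 2 - X $ 2) + axis 3 (x $ 3 - X $ 3)"
    by (simp add: vec_eq_iff forall_3 axis_def)
  have "(p x)\<^sup>2 \<le> C * (\<Sum>c\<in>{0, h}. (p (X + axis 1 (x $ 1 - X $ 1) + axis 2 (x $ 2 - X $ 2) + axis 3 c))\<^sup>2)"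
    by (subst x) (rule step)
  also have "\<dots> = C * (\<Sum>c\<in>{0, h}. (p (X + axis 1 (x $ 1 - X $ 1) + axis 3 c + axis 2 (x $ 2 - X $ 2)))\<^sup>2)"
    by (simp add: ac_simps)
  also have "\<dots> \<le> C * (\<Sum>c\<in>{0, h}. C * (\<Sum>b\<in>{0, h}. (p (X + axis 1 (x $ 1 - X $ 1) + axis 3 c + axis 2 b))\<^sup>2))"
    by (intro mult_left_mono sum_mono step C)
  also have "\<dots> = C * (\<Sum>c\<in>{0, h}. C * (\<Sum>b\<in>{0, h}. (p (X + axis 3 c + axis 2 b + axis 1 (x $ 1 - X $ 1)))\<^sup>2))"
    by (simp add: ac_simps)
  also have "\<dots> \<le> C * (\<Sum>c\<in>{0, h}. C * (\<Sum>b\<in>{0, h}. C * (\<Sum>a\<in>{0, h}. (p (X + axis 3 c + axis 2 b + axis 1 a))\<^sup>2)))"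
    by (intro mult_left_mono sum_mono step C)
  also have "\<dots> = C ^ 3 * (\<Sum>c\<in>{0, h}. \<Sum>b\<in>{0, h}. \<Sum>a\<in>{0, h}. (p (X + (axis 1 a + axis 2 b + axis 3 c)))\<^sup>2)"
    by (simp add: sum_distrib_left[symmetric] power3_eq_cube ac_simps)
  also have "(\<Sum>c\<in>{0, h}. \<Sum>b\<in>{0, h}. \<Sum>a\<in>{0, h}. (p (X + (axis 1 a + axis 2 b + axis 3 c)))\<^sup>2)
      = (\<Sum>(a, b, c)\<in>{0, h} \<times> {0, h} \<times> {0, h}. (p (X + (axis 1 a + axis 2 b + axis 3 c)))\<^sup>2)"
    using assms(2) by (simp add: sum.cartesian_product[symmetric] ac_simps)
  also have "C ^ 3 = 8 * (K + 1) ^ 6"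
    by (simp add: C_def power_mult_distrib power_mult[symmetric])
  finally show ?thesis .
qed

text \<open>The base point of the interpolation is free, so the estimate by eight values may be averaged over
a cube with side \<open>h\<close> and corner \<open>Y\<close>.  All eight shifts of this cube stay inside \<open>ball Y (4 * h)\<close>,
their points being at distance at most \<open>2 * sqrt 3 * h\<close> from \<open>Y\<close>; hence each contributes at most the
integral over \<open>S\<close>.\<close>
lemma multiaffine_point_bound:
  assumes "multiaffine p" "S \<in> sets borel" "S \<subseteq> cbox u v" "0 < h" "ball Y (4 * h) \<subseteq> S"
    and x: "\<And>i. \<bar>x $ i - Y $ i\<bar> \<le> K * h"
  shows "h ^ 3 * (p x)\<^sup>2 \<le> 64 * (K + 2) ^ 6 * (LINT X:S|lborel. (p X)\<^sup>2)"
proof -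
  define Q where "Q = cbox Y (\<chi> i. Y $ i + h)"
  define I where "I = {0, h} \<times> {0, h} \<times> {0, h}"
  define w :: "real \<times> real \<times> real \<Rightarrow> point" where
    "w = (\<lambda>(a, b, c). axis 1 a + axis 2 b + axis 3 c)"
  have K: "0 \<le> K" using x[of 1] assms(4) by (smt (verit) mult_less_0_iff)
  define C where "C = 8 * (K + 2) ^ 6"
  have pc: "continuous_on A p" for A using assms(1) by (rule multiaffine_continuous_on)
  have shc: "continuous_on UNIV (\<lambda>X. (p (X + z))\<^sup>2)" for z
    by (intro continuous_intros continuous_on_compose2[OF pc[of UNIV]]) auto
  have sh: "set_integrable lborel Q (\<lambda>X. (p (X + z))\<^sup>2)" for z
    by (rule continuous_set_integrable[OF shc]) (auto simp: Q_def)
  have Qle: "(LINT X:Q|lborel. (p (X + w k))\<^sup>2) \<le> (LINT X:S|lborel. (p X)\<^sup>2)" if k: "k \<in> I" for k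
  proof (rule integral_translate_le[OF _ assms(2,3)])
    show "continuous_on UNIV (\<lambda>X. (p X)\<^sup>2)" using pc by (intro continuous_intros)
    show "X + w k \<in> S" if "X \<in> Q" for X
    proof -
      have c: "\<bar>(X + w k - Y) $ i\<bar> \<le> 2 * h" for i
      proof -
        have "\<bar>w k $ i\<bar> \<le> h \<and> 0 \<le> w k $ i" using k assms(4) exhaust_3[of i] by (auto simp: w_def I_def axis_def)
        moreover have "Y $ i \<le> X $ i" "X $ i \<le> Y $ i + h"
          using that by (auto simp: Q_def mem_box_cart)
        ultimately show ?thesis by auto
      qed
      have "(norm (X + w k - Y))\<^sup>2 \<le> 3 * (2 * h)\<^sup>2" by (rule norm_sq_le_of_components[OF c])
      also have "\<dots> < (4 * h)\<^sup>2" using assms(4) by (simp add: power2_eq_square)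
      finally have "norm (X + w k - Y) < 4 * h"
        using assms(4) by (intro power2_less_imp_less[of _ "4 * h"]) auto
      then show ?thesis using assms(5) by (auto simp: dist_norm norm_minus_commute)
    qed
  qed (auto simp: Q_def)
  have pt: "(p x)\<^sup>2 \<le> C * (\<Sum>k\<in>I. (p (X + w k))\<^sup>2)" if "X \<in> Q" for X
  proof -
    have "\<bar>x $ i - X $ i\<bar> \<le> (K + 1) * h" for i
      using x[of i] that by (auto simp: Q_def mem_box_cart algebra_simps abs_le_iff) (smt (verit))+
    from multiaffine_corner_sum[OF assms(1,4) this]
    show ?thesis by (simp add: C_def I_def w_def case_prod_unfold add.assoc)
  qed
  have vol: "measure lborel Q = h ^ 3"
    unfolding Q_def
    by (subst content_cbox_cart) (use assms(4) in \<open>auto simp: interval_eq_empty_cart\<close>)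
  have "h ^ 3 * (p x)\<^sup>2 = (LINT X:Q|lborel. (p x)\<^sup>2)"
    unfolding vol[symmetric] set_lebesgue_integral_def by (simp add: Q_def)
  also have "\<dots> \<le> (LINT X:Q|lborel. C * (\<Sum>k\<in>I. (p (X + w k))\<^sup>2))"
  proof (rule set_integral_mono)
    show "set_integrable lborel Q (\<lambda>X. (p x)\<^sup>2)"
      by (rule continuous_set_integrable) (auto simp: Q_def)
    show "set_integrable lborel Q (\<lambda>X. C * (\<Sum>k\<in>I. (p (X + w k))\<^sup>2))"
      by (rule continuous_set_integrable) (auto simp: Q_def intro!: continuous_intros shc)
  qed (use pt in auto)
  also have "\<dots> = C * (\<Sum>k\<in>I. LINT X:Q|lborel. (p (X + w k))\<^sup>2)"
    using sh unfolding set_lebesgue_integral_def set_integrable_def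
    by (simp add: sum_distrib_left Bochner_Integration.integral_sum mult.left_commute)
  also have "\<dots> \<le> C * (\<Sum>k\<in>I. LINT X:S|lborel. (p X)\<^sup>2)"
    using K by (intro mult_left_mono sum_mono Qle) (auto simp: C_def)
  also have "\<dots> = C * (8 * (LINT X:S|lborel. (p X)\<^sup>2))"
    using assms(4) by (simp add: I_def card_cartesian_product)
  finally show ?thesis by (simp add: C_def)
qed


lemma set_integral_square_add_le:
  fixes f g :: "point \<Rightarrow> real"
  assumes "continuous_on UNIV f" "continuous_on UNIV g" "S \<in> sets borel" "S \<subseteq> cbox u v"
  shows "(LINT X:S|lborel. (f X + g X)\<^sup>2)
    \<le> 2 * (LINT X:S|lborel. (f X)\<^sup>2) + 2 * (LINT X:S|lborel. (g X)\<^sup>2)"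
proof -
  note int = continuous_set_integrable[OF _ assms(3,4)]
  have "(LINT X:S|lborel. (f X + g X)\<^sup>2) \<le> (LINT X:S|lborel. 2 * (f X)\<^sup>2 + 2 * (g X)\<^sup>2)"
  proof (rule set_integral_mono)
    show "(f X + g X)\<^sup>2 \<le> 2 * (f X)\<^sup>2 + 2 * (g X)\<^sup>2" for X
      using sum_squares_bound[of "f X" "g X"] by (simp add: power2_sum)
  qed (auto intro!: int continuous_intros assms(1,2))
  also have "\<dots> = (LINT X:S|lborel. 2 * (f X)\<^sup>2) + (LINT X:S|lborel. 2 * (g X)\<^sup>2)"
    by (rule set_integral_add) (auto intro!: int continuous_intros assms(1,2))
  finally show ?thesis by simp
qed

text \<open>The inverse inequality behind the theorem, for both operators at once: \<open>c\<close> is the coefficient of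
the added term.  For \<open>j = 0\<close> the derivative in direction \<open>i\<close> at \<open>F\<close> is the difference quotient of
\<open>p\<close> between \<open>F\<close> and \<open>F + axis i h\<close>, so the point bound applies to \<open>p\<close> itself; for \<open>j = 1\<close> the point
bound is applied to the partial derivatives.  The powers of \<open>h\<close> cancel because \<open>S\<close> has measure at
most \<open>(M * h) ^ 3\<close> and \<open>(X - F) \<bullet> n\<close> is at most of order \<open>M * h\<close>.\<close>
lemma extension_bound_sq:
  assumes p: "p \<in> Q1" and S: "S \<in> sets borel" "S \<subseteq> cbox u v"
    and h: "0 < h" "ball Y (4 * h) \<subseteq> S" and M: "\<And>i. v $ i - u $ i \<le> M * h"
    and F: "F \<in> cbox u v" and n: "norm n = 1" and j: "j \<in> {0, 1}"
  shows "H_seminorm_sq j S (\<lambda>X. p X + c * (grad p F \<bullet> n) * ((X - F) \<bullet> n))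
    \<le> (2 + c\<^sup>2 * (72 * (64 * (M + 3) ^ 6) * (M ^ 5 + M ^ 3))) * H_seminorm_sq j S p"
proof -
  define G where "G = 64 * (M + 3) ^ 6"
  define d where "d = grad p F \<bullet> n"
  have ma: "multiaffine p" using p by (rule Q1_multiaffine)
  have pc: "continuous_on A p" for A using ma by (rule multiaffine_continuous_on)
  define q where "q i = (\<lambda>X. p (X + axis i 1) - p X)" for i
  have gp: "grad p X $ i = q i X" for X i
    using grad_multiaffine[OF ma Q1_differentiable[OF p]] by (simp add: q_def)
  have maq: "multiaffine (q i)" for i unfolding q_def by (rule multiaffine_difference[OF ma])
  have qc: "continuous_on A (q i)" for A i using maq by (rule multiaffine_continuous_on)
  have Y: "Y \<in> cbox u v" using h S by (meson centre_in_ball mult_pos_pos subsetD zero_less_numeral)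
  have bnd: "\<bar>X $ i - X' $ i\<bar> \<le> M * h" if "X \<in> cbox u v" "X' \<in> cbox u v" for X X' i
  proof -
    have "u $ i \<le> X $ i" "X $ i \<le> v $ i" "u $ i \<le> X' $ i" "X' $ i \<le> v $ i"
      using that by (auto simp: mem_box_cart)
    then show ?thesis using M[of i] by linarith
  qed
  have M0: "0 \<le> M" using bnd[OF F Y, of 1] h(1) by (smt (verit) mult_less_0_iff)
  have G0: "0 \<le> G" using M0 by (simp add: G_def)
  have pt: "h ^ 3 * (g x)\<^sup>2 \<le> G * (LINT X:S|lborel. (g X)\<^sup>2)"
    if "multiaffine g" "x = F \<or> x = F + axis i h" for g x i
  proof -
    \<comment> \<open>the point \<open>F + axis i h\<close> may lie outside the cell, but by at most \<open>h\<close>\<close>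
    have "\<bar>x $ k - Y $ k\<bar> \<le> (M + 1) * h" for k
      using bnd[OF F Y, of k] that(2) h(1) by (auto simp: axis_def algebra_simps)
    from multiaffine_point_bound[OF that(1) S h this]
    show ?thesis by (simp add: G_def add.commute)
  qed
  have d2: "d\<^sup>2 \<le> (\<Sum>i\<in>UNIV. (q i F)\<^sup>2)"
  proof -
    have "\<bar>d\<bar> \<le> norm (grad p F)" using Cauchy_Schwarz_ineq2[of "grad p F" n] n by (simp add: d_def)
    then have "d\<^sup>2 \<le> (norm (grad p F))\<^sup>2" by (metis abs_ge_zero power2_abs power_mono)
    then show ?thesis by (simp add: norm_vec_def L2_set_def sum_nonneg gp)
  qed
  have Sm: "emeasure lborel S < \<infinity>"
    using emeasure_mono[OF S(2), of lborel] emeasure_lborel_cbox_finite[of u v]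
    by (auto simp: less_top[symmetric] top_unique)
  have volS: "measure lborel S \<le> (M * h) ^ 3"
  proof -
    have "measure lborel S \<le> measure lborel (cbox u v)"
      using S by (intro measure_mono_fmeasurable) auto
    also have "\<dots> = (\<Prod>i\<in>UNIV. v $ i - u $ i)" using F by (subst content_cbox_cart) auto
    also have "\<dots> \<le> (\<Prod>i\<in>(UNIV :: 3 set). M * h)"
      using F M by (intro prod_mono) (auto simp: mem_box_cart intro: order_trans)
    finally show ?thesis by simp
  qed
  have const: "(LINT X:S|lborel. k) = k * measure lborel S" for k :: real
    using S Sm by (simp add: set_lebesgue_integral_def)
  consider "j = 0" | "j = 1" using j by auto
  then show ?thesis
  proof cases
    case 1
    define N where "N = (LINT X:S|lborel. (p X)\<^sup>2)"
    have N0: "0 \<le> N" unfolding N_def set_lebesgue_integral_def by (simp add: integral_nonneg)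
    have q1: "h ^ 5 * (q i F)\<^sup>2 \<le> 4 * G * N" for i
    proof -
      have "p (F + axis i h) = p F + h * q i F"
        using ma unfolding multiaffine_def q_def by blast
      then have "h * q i F = p (F + axis i h) - p F" by simp
      then have "h\<^sup>2 * (q i F)\<^sup>2 = (p (F + axis i h) - p F)\<^sup>2" by (metis power_mult_distrib)
      also have "\<dots> \<le> 2 * (p (F + axis i h))\<^sup>2 + 2 * (p F)\<^sup>2"
        using sum_squares_bound[of "p (F + axis i h)" "- p F"] by (simp add: power2_diff)
      finally have "h ^ 3 * (h\<^sup>2 * (q i F)\<^sup>2) \<le> h ^ 3 * (2 * (p (F + axis i h))\<^sup>2 + 2 * (p F)\<^sup>2)"
        using h(1) by (intro mult_left_mono) auto
      also have "\<dots> = 2 * (h ^ 3 * (p (F + axis i h))\<^sup>2) + 2 * (h ^ 3 * (p F)\<^sup>2)"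
        by (simp add: algebra_simps)
      also have "\<dots> \<le> 4 * G * N"
        using pt[OF ma, of "F + axis i h" i] pt[OF ma, of F i] by (simp add: N_def)
      also have "h ^ 3 * (h\<^sup>2 * (q i F)\<^sup>2) = h ^ 5 * (q i F)\<^sup>2"
        by (simp add: power_add[symmetric] flip: mult.assoc)
      finally show ?thesis .
    qed
    have "h ^ 5 * d\<^sup>2 \<le> h ^ 5 * (\<Sum>i\<in>UNIV. (q i F)\<^sup>2)"
      using d2 h(1) by (intro mult_left_mono) auto
    also have "\<dots> \<le> (\<Sum>i\<in>(UNIV :: 3 set). 4 * G * N)"
      unfolding sum_distrib_left by (intro sum_mono q1)
    finally have d5: "h ^ 5 * d\<^sup>2 \<le> 12 * G * N" by simp
    have L: "(LINT X:S|lborel. (c * d * ((X - F) \<bullet> n))\<^sup>2) \<le> c\<^sup>2 * (36 * G * M ^ 5) * N"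
    proof -
      have "(LINT X:S|lborel. (c * d * ((X - F) \<bullet> n))\<^sup>2)
          \<le> (LINT X:S|lborel. c\<^sup>2 * d\<^sup>2 * (3 * (M * h)\<^sup>2))"
      proof (rule set_integral_mono)
        fix X assume X: "X \<in> S"
        have "((X - F) \<bullet> n)\<^sup>2 \<le> (norm (X - F))\<^sup>2"
          using Cauchy_Schwarz_ineq2[of "X - F" n] n by (metis abs_ge_zero mult.right_neutral power2_abs power_mono)
        also have "\<dots> \<le> 3 * (M * h)\<^sup>2"
          using norm_sq_le_of_components[of "X - F" "M * h"] bnd[OF _ F] X S(2) by auto
        finally show "(c * d * ((X - F) \<bullet> n))\<^sup>2 \<le> c\<^sup>2 * d\<^sup>2 * (3 * (M * h)\<^sup>2)"
          by (simp only: power_mult_distrib[of "c * d"] power_mult_distrib[of c]) (intro mult_left_mono, auto)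
      qed (auto intro!: continuous_set_integrable[OF _ S] continuous_intros)
      also have "\<dots> = c\<^sup>2 * d\<^sup>2 * (3 * (M * h)\<^sup>2) * measure lborel S" by (rule const)
      also have "\<dots> \<le> c\<^sup>2 * d\<^sup>2 * (3 * (M * h)\<^sup>2) * (M * h) ^ 3"
        using volS by (intro mult_left_mono) auto
      also have "\<dots> = 3 * c\<^sup>2 * M ^ 5 * (h ^ 5 * d\<^sup>2)"
        by (simp add: power_mult_distrib power_numeral_reduce)
      also have "\<dots> \<le> 3 * c\<^sup>2 * M ^ 5 * (12 * G * N)"
        using d5 M0 by (intro mult_left_mono) auto
      finally show ?thesis by (simp add: mult_ac)
    qed
    have "(LINT X:S|lborel. (p X + c * d * ((X - F) \<bullet> n))\<^sup>2)
        \<le> 2 * N + 2 * (c\<^sup>2 * (36 * G * M ^ 5) * N)"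
      using set_integral_square_add_le[OF pc _ S, of "\<lambda>X. c * d * ((X - F) \<bullet> n)"] L
      by (force simp: N_def intro!: continuous_intros)
    also have "\<dots> = (2 + c\<^sup>2 * (72 * G * M ^ 5)) * N" by (simp add: algebra_simps)
    also have "\<dots> \<le> (2 + c\<^sup>2 * (72 * G * (M ^ 5 + M ^ 3))) * N"
      using M0 G0 N0 by (intro mult_right_mono add_left_mono mult_left_mono) auto
    finally show ?thesis using 1 by (simp add: N_def d_def G_def)
  next
    case 2
    define N where "N i = (LINT X:S|lborel. (q i X)\<^sup>2)" for i
    have N0: "0 \<le> N i" for i unfolding N_def set_lebesgue_integral_def by (simp add: integral_nonneg)
    have ge: "grad (\<lambda>X. p X + c * d * ((X - F) \<bullet> n)) X $ i = q i X + c * d * n $ i" for X i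
    proof -
      have "(p has_derivative frechet_derivative p (at X)) (at X)"
        using Q1_differentiable[OF p] by (simp add: frechet_derivative_works)
      then have "((\<lambda>X. p X + c * d * ((X - F) \<bullet> n)) has_derivative
          (\<lambda>v. frechet_derivative p (at X) v + c * d * (v \<bullet> n))) (at X)"
        by (auto intro!: derivative_eq_intros)
      then show ?thesis using gp[of X i]
        by (simp add: grad_def frechet_derivative_at[symmetric] inner_axis')
    qed
    have d3: "h ^ 3 * d\<^sup>2 \<le> G * (\<Sum>i\<in>UNIV. N i)"
    proof -
      have "h ^ 3 * d\<^sup>2 \<le> h ^ 3 * (\<Sum>i\<in>UNIV. (q i F)\<^sup>2)"
        using d2 h(1) by (intro mult_left_mono) auto
      also have "\<dots> \<le> (\<Sum>i\<in>UNIV. G * N i)"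
        unfolding sum_distrib_left N_def by (intro sum_mono pt[OF maq]) auto
      finally show ?thesis by (simp add: sum_distrib_left)
    qed
    have "(\<Sum>i\<in>UNIV. LINT X:S|lborel. (q i X + c * d * n $ i)\<^sup>2)
        \<le> (\<Sum>i\<in>UNIV. 2 * N i + 2 * ((c * d * n $ i)\<^sup>2 * measure lborel S))"
      unfolding const[symmetric] N_def
      by (intro sum_mono set_integral_square_add_le[OF qc _ S] continuous_intros)
    also have "\<dots> = 2 * (\<Sum>i\<in>UNIV. N i) + 2 * (c\<^sup>2 * d\<^sup>2 * measure lborel S) * (\<Sum>i\<in>UNIV. (n $ i)\<^sup>2)"
      unfolding sum.distrib sum_distrib_left by (simp add: power_mult_distrib mult_ac)
    also have "(\<Sum>i\<in>UNIV. (n $ i)\<^sup>2) = 1"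
      using n by (simp add: norm_vec_def L2_set_def)
    also have "2 * (\<Sum>i\<in>UNIV. N i) + 2 * (c\<^sup>2 * d\<^sup>2 * measure lborel S) * 1
        \<le> 2 * (\<Sum>i\<in>UNIV. N i) + 2 * (c\<^sup>2 * d\<^sup>2 * (M * h) ^ 3)"
      using volS by (simp add: mult_left_mono)
    also have "\<dots> = 2 * (\<Sum>i\<in>UNIV. N i) + 2 * c\<^sup>2 * M ^ 3 * (h ^ 3 * d\<^sup>2)"
      by (simp add: power_mult_distrib)
    also have "\<dots> \<le> 2 * (\<Sum>i\<in>UNIV. N i) + 2 * c\<^sup>2 * M ^ 3 * (G * (\<Sum>i\<in>UNIV. N i))"
      using d3 M0 by (intro add_left_mono mult_left_mono) auto
    also have "\<dots> = (2 + c\<^sup>2 * (2 * G * M ^ 3)) * (\<Sum>i\<in>UNIV. N i)" by (simp add: algebra_simps)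
    also have "\<dots> \<le> (2 + c\<^sup>2 * (72 * G * (M ^ 5 + M ^ 3))) * (\<Sum>i\<in>UNIV. N i)"
    proof (intro mult_right_mono add_left_mono mult_left_mono)
      have "0 \<le> G * M ^ 5" "0 \<le> G * M ^ 3" using G0 M0 by auto
      then show "2 * G * M ^ 3 \<le> 72 * G * (M ^ 5 + M ^ 3)" by (simp add: algebra_simps)
    qed (auto intro: sum_nonneg N0)
    finally show ?thesis using 2 by (simp add: N_def d_def[symmetric] G_def ge gp)
  qed
qed

section \<open>Balls tangent to the interface\<close>

text \<open>If \<open>z\<close> is the component of \<open>g\<close> orthogonal to \<open>w\<close>, then \<open>t *\<^sub>R w - z\<close> lies in the half space for
every \<open>t > 0\<close>, and letting \<open>t\<close> become small shows \<open>0 \<le> - (z \<bullet> z)\<close>.\<close>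
lemma proportional_if_halfspace:
  fixes g w :: "'a::real_inner"
  assumes "\<And>y. 0 < y \<bullet> w \<Longrightarrow> 0 \<le> g \<bullet> y" "w \<noteq> 0"
  shows "g = ((g \<bullet> w) / (w \<bullet> w)) *\<^sub>R w"
proof (rule ccontr)
  define z where "z = g - ((g \<bullet> w) / (w \<bullet> w)) *\<^sub>R w"
  assume "\<not> ?thesis"
  then have z: "z \<noteq> 0" by (simp add: z_def)
  have ww: "0 < w \<bullet> w" using assms(2) by simp
  have zw: "z \<bullet> w = 0" using ww by (simp add: z_def inner_diff_left)
  have gz: "g \<bullet> z = z \<bullet> z"
  proof -
    have "g = z + ((g \<bullet> w) / (w \<bullet> w)) *\<^sub>R w" by (simp add: z_def)
    then have "g \<bullet> z = z \<bullet> z + ((g \<bullet> w) / (w \<bullet> w)) * (w \<bullet> z)"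
      by (metis inner_add_left inner_scaleR_left)
    then show ?thesis using zw by (simp add: inner_commute)
  qed
  have zz: "0 < z \<bullet> z" using z by simp
  define t where "t = z \<bullet> z / (2 * (\<bar>g \<bullet> w\<bar> + 1))"
  have t: "0 < t" using zz by (simp add: t_def)
  have "0 \<le> g \<bullet> (t *\<^sub>R w - z)"
    using ww zw t by (intro assms(1)) (simp add: inner_diff_left)
  then have "z \<bullet> z \<le> t * (g \<bullet> w)" by (simp add: inner_diff_right gz)
  also have "\<dots> \<le> t * (\<bar>g \<bullet> w\<bar> + 1)" using t by (intro mult_left_mono) auto
  also have "\<dots> = z \<bullet> z / 2" by (simp add: t_def field_simps)
  finally show False using zz by simp
qed

lemma constant_sign_on_convex:
  fixes f :: "point \<Rightarrow> real"
  assumes "convex S" "continuous_on S f" "\<And>x. x \<in> S \<Longrightarrow> f x \<noteq> 0"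
  shows "(\<forall>x\<in>S. 0 < f x) \<or> (\<forall>x\<in>S. f x < 0)"
proof -
  have "connected (f ` S)"
    using assms(1,2) by (intro connected_continuous_image convex_connected)
  then have "is_interval (f ` S)" by (simp add: is_interval_connected_1)
  then have "0 \<in> f ` S" if "x \<in> S" "y \<in> S" "f x < 0" "0 < f y" for x y
    using that unfolding is_interval_1 by (meson imageI less_imp_le)
  then show ?thesis
    using assms(3) by (metis imageE linorder_neqE_linordered_idom)
qed

lemma local_equation_has_derivative:
  assumes "local_C2_equation \<Gamma> X U f" "x \<in> U"
  shows "(f has_derivative (\<lambda>v. grad f x \<bullet> v)) (at x)"
  using assms unfolding local_C2_equation_def C2_on_def by blast

lemma local_equation_continuous_on:
  assumes "local_C2_equation \<Gamma> X U f"
  shows "continuous_on U f" "continuous_on U (grad f)"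
proof -
  show "continuous_on U f"
    using local_equation_has_derivative[OF assms] has_derivative_continuous
    by (blast intro: continuous_at_imp_continuous_on)
  obtain H :: "point \<Rightarrow> real^3^3"
    where "\<forall>x\<in>U. (grad f has_derivative (\<lambda>v. H x *v v)) (at x)"
    using assms unfolding local_C2_equation_def C2_on_def by blast
  then show "continuous_on U (grad f)"
    using has_derivative_continuous by (blast intro: continuous_at_imp_continuous_on)
qed

lemma positive_side_derivative:
  fixes f :: "point \<Rightarrow> real"
  assumes "(f has_derivative (\<lambda>v. g \<bullet> v)) (at Y)" "f Y = 0" "0 < e"
    and "\<And>t. 0 < t \<Longrightarrow> t < e \<Longrightarrow> 0 \<le> f (Y + t *\<^sub>R y)"
  shows "0 \<le> g \<bullet> y"
proof -
  have "((\<lambda>t. f (Y + t *\<^sub>R y)) has_derivative (\<lambda>t. g \<bullet> (t *\<^sub>R y))) (at 0)"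
  proof -
    have "((\<lambda>t. Y + t *\<^sub>R y) has_derivative (\<lambda>t. t *\<^sub>R y)) (at 0)"
      by (auto intro!: derivative_eq_intros)
    then show ?thesis
      using has_derivative_compose[of "\<lambda>t. Y + t *\<^sub>R y" "\<lambda>t. t *\<^sub>R y" 0 UNIV f "\<lambda>v. g \<bullet> v"] assms(1)
      by simp
  qed
  then have "((\<lambda>t. f (Y + t *\<^sub>R y)) has_real_derivative (g \<bullet> y)) (at 0)"
    by (simp add: has_field_derivative_def mult_commute_abs)
  then have "((\<lambda>t. f (Y + t *\<^sub>R y) / t) \<longlongrightarrow> g \<bullet> y) (at_right 0)"
    unfolding DERIV_def using assms(2) by (auto intro: filterlim_mono simp: at_within_le_at filterlim_at_split)
  moreover have "eventually (\<lambda>t. 0 \<le> f (Y + t *\<^sub>R y) / t) (at_right 0)"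
    using assms(3,4) unfolding eventually_at_right_field by (auto intro!: exI[of _ e])
  ultimately show ?thesis by (intro tendsto_lowerbound) auto
qed

text \<open>A first-order condition, obtained without a parametrisation of \<open>\<Gamma>\<close>.  Near \<open>Y\<close> the defining function does
not vanish inside the ball around \<open>Z\<close>, hence has constant sign there; every direction
pointing into the ball therefore has derivative of that sign, and the gradient at \<open>Y\<close> has to be a
multiple of \<open>Z - Y\<close>.\<close>
lemma nearest_point_normal:
  assumes "local_C2_equation \<Gamma> Y U f" "Z \<noteq> Y" "ball Z (dist Y Z) \<inter> \<Gamma> = {}"
  shows "Z = Y + dist Y Z *\<^sub>R sgn (grad f Y) \<or> Z = Y - dist Y Z *\<^sub>R sgn (grad f Y)"
proof -
  define w where "w = Z - Y"
  define g where "g = grad f Y"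
  define d where "d = dist Y Z"
  have w: "w \<noteq> 0" "norm w = d" using assms(2) by (auto simp: w_def d_def dist_norm norm_minus_commute)
  have d: "0 < d" using assms(2) by (simp add: d_def)
  have U: "open U" "Y \<in> U" "Y \<in> \<Gamma>" "\<Gamma> \<inter> U = {x \<in> U. f x = 0}" "\<forall>x\<in>U. grad f x \<noteq> 0"
    using assms(1) by (auto simp: local_C2_equation_def)
  have g0: "g \<noteq> 0" using U by (simp add: g_def)
  have fY: "f Y = 0" using U by blast
  obtain e where e: "0 < e" "ball Y e \<subseteq> U" using U(1,2) open_contains_ball by blast
  let ?S = "ball Z d \<inter> ball Y e"
  have S0: "f x \<noteq> 0" if "x \<in> ?S" for x
    using that e U(4) assms(3) unfolding d_def by blast
  have "convex ?S" by (intro convex_Int convex_ball)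
  moreover have "continuous_on ?S f"
    using local_equation_continuous_on(1)[OF assms(1)] e by (blast intro: continuous_on_subset)
  ultimately have sg: "(\<forall>x\<in>?S. 0 < f x) \<or> (\<forall>x\<in>?S. f x < 0)"
    using S0 by (rule constant_sign_on_convex)
  \<comment> \<open>every direction \<open>y\<close> with \<open>0 < y \<bullet> w\<close> enters the ball around \<open>Z\<close>\<close>
  have inS: "\<exists>s>0. \<forall>t. 0 < t \<and> t < s \<longrightarrow> Y + t *\<^sub>R y \<in> ?S" if y: "0 < y \<bullet> w" for y
  proof -
    have y0: "y \<noteq> 0" using y by auto
    define s where "s = min (e / norm y) (y \<bullet> w / (y \<bullet> y))"
    have "0 < s" using y0 y e by (simp add: s_def)
    moreover have "Y + t *\<^sub>R y \<in> ?S" if t: "0 < t" "t < s" for t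
    proof -
      have "t * norm y < e" using t y0 by (simp add: s_def field_simps)
      then have b: "Y + t *\<^sub>R y \<in> ball Y e" using t by (simp add: dist_norm)
      have "t * (y \<bullet> y) < y \<bullet> w" using t y0 by (simp add: s_def field_simps)
      then have "t * (t * (y \<bullet> y)) < t * (y \<bullet> w)" using t by simp
      moreover have "0 < t * (y \<bullet> w)" using t y by simp
      ultimately have "t * (t * (y \<bullet> y)) - 2 * (t * (y \<bullet> w)) < 0" by linarith
      moreover have "(norm (w - t *\<^sub>R y))\<^sup>2 = (norm w)\<^sup>2 + (t * (t * (y \<bullet> y)) - 2 * (t * (y \<bullet> w)))"
        unfolding power2_norm_eq_inner by (simp add: inner_diff_left inner_diff_right inner_commute[of w y] right_diff_distrib)
      ultimately have "(norm (w - t *\<^sub>R y))\<^sup>2 < (norm w)\<^sup>2" by linarith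
      then have "(norm (w - t *\<^sub>R y))\<^sup>2 < d\<^sup>2" unfolding w(2) .
      then have "norm (w - t *\<^sub>R y) < d" by (rule power2_less_imp_less) (use d in simp)
      moreover have e: "Z - (Y + t *\<^sub>R y) = w - t *\<^sub>R y" by (simp add: w_def)
      ultimately have "Y + t *\<^sub>R y \<in> ball Z d" unfolding mem_ball dist_norm e by simp
      with b show ?thesis by blast
    qed
    ultimately show ?thesis by blast
  qed
  have hd: "(f has_derivative (\<lambda>v. g \<bullet> v)) (at Y)"
    unfolding g_def by (rule local_equation_has_derivative[OF assms(1) U(2)])
  have hm: "((\<lambda>x. - f x) has_derivative (\<lambda>v. (- g) \<bullet> v)) (at Y)"
    using has_derivative_minus[OF hd] by simp
  have "\<exists>k. g = k *\<^sub>R w"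
    using sg
  proof
    assume pos: "\<forall>x\<in>?S. 0 < f x"
    have "0 \<le> g \<bullet> y" if y: "0 < y \<bullet> w" for y
    proof -
      obtain s where s: "0 < s" "\<forall>t. 0 < t \<and> t < s \<longrightarrow> Y + t *\<^sub>R y \<in> ?S" using inS[OF y] by blast
      show ?thesis
        by (rule positive_side_derivative[OF hd fY s(1)]) (use s(2) pos in \<open>auto intro: less_imp_le\<close>)
    qed
    from proportional_if_halfspace[OF this w(1)] show ?thesis by blast
  next
    assume neg: "\<forall>x\<in>?S. f x < 0"
    have "0 \<le> (- g) \<bullet> y" if y: "0 < y \<bullet> w" for y
    proof -
      obtain s where s: "0 < s" "\<forall>t. 0 < t \<and> t < s \<longrightarrow> Y + t *\<^sub>R y \<in> ?S" using inS[OF y] by blast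
      show ?thesis
        by (rule positive_side_derivative[OF hm _ s(1)]) (use fY s(2) neg in \<open>auto intro: less_imp_le\<close>)
    qed
    from proportional_if_halfspace[OF this w(1)] show ?thesis
      by (metis minus_equation_iff scaleR_minus_left)
  qed
  then obtain k where k: "g = k *\<^sub>R w" by blast
  with g0 have "k \<noteq> 0" by auto
  then have "w = d *\<^sub>R sgn g \<or> w = - (d *\<^sub>R sgn g)"
    unfolding k sgn_scaleR using w d by (cases "0 < k") (auto simp: sgn_div_norm)
  moreover have "Z = Y + w" by (simp add: w_def)
  ultimately show ?thesis unfolding g_def d_def by auto
qed

lemma unit_normal_minus:
  assumes "unit_normal \<Gamma> X n" shows "unit_normal \<Gamma> X (- n)"
proof -
  obtain U f where f: "local_C2_equation \<Gamma> X U f" and n: "n = sgn (grad f X)"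
    using assms by (auto simp: unit_normal_def)
  have hd: "(f has_derivative (\<lambda>v. grad f x \<bullet> v)) (at x)" if "x \<in> U" for x
    using local_equation_has_derivative[OF f that] .
  have g: "grad (\<lambda>x. - f x) x = - grad f x" if "x \<in> U" for x
  proof -
    have "((\<lambda>x. - f x) has_derivative (\<lambda>v. - (grad f x \<bullet> v))) (at x)"
      using hd[OF that] by (rule has_derivative_minus)
    then show ?thesis
      by (simp add: grad_def[of "\<lambda>x. - f x"] frechet_derivative_at[symmetric] vec_eq_iff inner_axis)
  qed
  obtain H :: "point \<Rightarrow> real^3^3" where H: "continuous_on U H"
    "\<forall>x\<in>U. (grad f has_derivative (\<lambda>v. H x *v v)) (at x)"
    and U: "open U" "X \<in> U"
    using f unfolding local_C2_equation_def C2_on_def by blast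
  have "C2_on U (\<lambda>x. - f x)"
    unfolding C2_on_def
  proof (intro exI[of _ "\<lambda>x. - H x"] conjI ballI)
    show "continuous_on U (\<lambda>x. - H x)" using H(1) by (rule continuous_on_minus)
    fix x assume x: "x \<in> U"
    show "((\<lambda>x. - f x) has_derivative (\<lambda>v. grad (\<lambda>x. - f x) x \<bullet> v)) (at x)"
      using has_derivative_minus[OF hd[OF x]] by (simp add: g[OF x])
    have "((\<lambda>x. - grad f x) has_derivative (\<lambda>v. - (H x *v v))) (at x)"
      using H(2) x by (blast intro: has_derivative_minus)
    then have "(grad (\<lambda>x. - f x) has_derivative (\<lambda>v. - (H x *v v))) (at x)"
      by (rule has_derivative_transform_within_open[OF _ U(1) x]) (simp add: g)
    moreover have "- H x *v v = - (H x *v v)" for v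
      by (simp add: matrix_vector_mult_def vec_eq_iff sum_negf)
    ultimately show "(grad (\<lambda>x. - f x) has_derivative (\<lambda>v. - H x *v v)) (at x)"
      by simp
  qed
  then have "local_C2_equation \<Gamma> X U (\<lambda>x. - f x)"
    using f g by (auto simp: local_C2_equation_def)
  then show ?thesis
    unfolding unit_normal_def using g[OF U(2)] n
    by (intro exI[of _ U] exI[of _ "\<lambda>x. - f x"]) (simp add: sgn_minus)
qed

text \<open>This is the form in which the reach is used.  If the ball met \<open>\<Gamma>\<close>, the point of \<open>\<Gamma>\<close> nearest to the
centre would differ from \<open>X\<close>, and by the first-order condition the centre would lie on
the normal segments of both points.\<close>
lemma tangent_ball_avoids_surface:
  assumes "closed_C2_surface \<Gamma>" "0 < r" "disjoint_family_on (\<lambda>X. normal_segment \<Gamma> X r) \<Gamma>"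
    and "X \<in> \<Gamma>" "unit_normal \<Gamma> X n"
  shows "ball (X + r *\<^sub>R n) r \<inter> \<Gamma> = {}"
proof (rule ccontr)
  define Z where "Z = X + r *\<^sub>R n"
  assume "\<not> ?thesis"
  then obtain W where W: "W \<in> \<Gamma>" "dist Z W < r" by (auto simp: Z_def)
  have cpt: "compact \<Gamma>" using assms(1) by (simp add: closed_C2_surface_def)
  obtain Y where Y: "Y \<in> \<Gamma>" "\<And>V. V \<in> \<Gamma> \<Longrightarrow> dist Z Y \<le> dist Z V"
    using distance_attains_inf[OF compact_imp_closed[OF cpt], of Z] W by blast
  have d: "dist Z Y < r" using Y(2)[OF W(1)] W(2) by simp
  obtain U f where f: "local_C2_equation \<Gamma> Y U f"
    using assms(1) Y(1) unfolding closed_C2_surface_def by blast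
  have un: "unit_normal \<Gamma> Y (sgn (grad f Y))" using f by (auto simp: unit_normal_def)
  have "\<exists>t m. \<bar>t\<bar> \<le> r \<and> unit_normal \<Gamma> Y m \<and> Z = Y + t *\<^sub>R m"
  proof (cases "Z = Y")
    \<comment> \<open>the centre may lie on \<open>\<Gamma>\<close> itself; then it is the midpoint of its own normal segment\<close>
    case True then show ?thesis using un assms(2) by (intro exI[of _ 0] exI) auto
  next
    case False
    have "ball Z (dist Y Z) \<inter> \<Gamma> = {}" using Y(2) by (force simp: dist_commute)
    from nearest_point_normal[OF f False this] show ?thesis
    proof
      assume "Z = Y + dist Y Z *\<^sub>R sgn (grad f Y)"
      then show ?thesis using un d by (intro exI[of _ "dist Y Z"] exI) (auto simp: dist_commute)
    next
      assume "Z = Y - dist Y Z *\<^sub>R sgn (grad f Y)"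
      then show ?thesis using un d by (intro exI[of _ "- dist Y Z"] exI) (auto simp: dist_commute)
    qed
  qed
  then have "Z \<in> normal_segment \<Gamma> Y r" by (auto simp: normal_segment_def)
  moreover have "Z \<in> normal_segment \<Gamma> X r"
    using assms(2,5) by (force simp: normal_segment_def Z_def)
  moreover have "norm n = 1"
    using assms(5) by (auto simp: unit_normal_def local_C2_equation_def norm_sgn)
  then have "dist Z X = r" using assms(2) by (simp add: Z_def dist_norm)
  then have "X \<noteq> Y" using d by auto
  ultimately show False
    using assms(3,4) Y(1) by (auto simp: disjoint_family_on_def)
qed

text \<open>Since \<open>0\<close> is admissible, the supremum would be at most \<open>k\<close> if all admissible radii were.  The
argument also covers an unbounded set of radii, the supremum of which is an unspecified number.\<close>
lemma reach_admissible_radius: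
  assumes "k < surface_reach \<Gamma>"
  obtains r where "k < r" "disjoint_family_on (\<lambda>X. normal_segment \<Gamma> X r) \<Gamma>"
proof -
  let ?R = "{r. 0 \<le> r \<and> disjoint_family_on (\<lambda>X. normal_segment \<Gamma> X r) \<Gamma>}"
  have "0 \<in> ?R" by (auto simp: disjoint_family_on_def normal_segment_def)
  have "\<exists>r\<in>?R. k < r"
  proof (rule ccontr)
    assume "\<not> ?thesis"
    then have le: "\<And>r. r \<in> ?R \<Longrightarrow> r \<le> k" by force
    have "Sup ?R \<le> k" using \<open>0 \<in> ?R\<close> le by (intro cSup_least) blast+
    then show False using assms by (simp add: surface_reach_def)
  qed
  then show ?thesis using that by blast
qed

section \<open>The two sides of the interface\<close>

lemma norm_axis_real: "norm (axis i x :: point) = \<bar>x\<bar>"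
proof -
  have "axis i x = x *\<^sub>R (axis i 1 :: point)" by (simp add: vec_eq_iff axis_def)
  then show ?thesis by (simp add: norm_axis_1)
qed

lemma separates_swap: "separates \<Gamma> \<Omega> D1 D2 \<Longrightarrow> separates \<Gamma> \<Omega> D2 D1"
  by (auto simp: separates_def)

lemma connected_subset_subdomain:
  assumes "separates \<Gamma> \<Omega> D1 D2" "connected S" "S \<subseteq> \<Omega>" "S \<inter> \<Gamma> = {}"
  shows "S \<subseteq> D1 \<or> S \<subseteq> D2"
proof -
  have D: "open D1" "open D2" "D1 \<inter> D2 = {}" "\<Omega> - \<Gamma> = D1 \<union> D2"
    using assms(1) by (simp_all add: separates_def)
  then have "S \<subseteq> D1 \<union> D2" using assms(3,4) by blast
  then show ?thesis
    using connectedD[OF assms(2) D(1,2)] D(3) by blast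
qed

text \<open>The sides also contain points on the boundary of the box.  There the closures of the two subdomains
are still disjoint away from \<open>\<Gamma>\<close>, because a small ball intersected with the open box is convex and
hence contained in a single subdomain.\<close>
lemma connected_subset_side:
  assumes "separates \<Gamma> (box a b) D1 D2" "compact \<Gamma>"
    and "connected S" "S \<subseteq> cbox a b" "S \<inter> \<Gamma> = {}" "x \<in> S" "x \<in> side \<Gamma> D2"
  shows "S \<subseteq> side \<Gamma> D2"
proof -
  have D: "D1 \<inter> D2 = {}" "box a b - \<Gamma> = D1 \<union> D2" "\<Gamma> \<subseteq> box a b" "D1 \<noteq> {}"
    using assms(1) by (simp_all add: separates_def)
  have ne: "box a b \<noteq> {}" using D by blast
  have cl: "closed \<Gamma>" using assms(2) by (rule compact_imp_closed)
  have "box a b = D1 \<union> D2 \<union> \<Gamma>" using D by blast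
  then have "cbox a b = closure (D1 \<union> D2 \<union> \<Gamma>)" using closure_box[OF ne] by simp
  then have cover: "cbox a b = closure D1 \<union> closure D2 \<union> \<Gamma>" using cl by simp
  have "closure D1 \<inter> closure D2 \<inter> S = {}"
  proof (rule ccontr)
    assume "\<not> ?thesis"
    then obtain z where z: "z \<in> closure D1" "z \<in> closure D2" "z \<in> S" by blast
    then have "z \<in> - \<Gamma>" using assms(5) by blast
    then obtain e where e: "0 < e" "ball z e \<subseteq> - \<Gamma>"
      using cl open_contains_ball[of "- \<Gamma>"] by (auto simp: open_Compl)
    have "connected (ball z e \<inter> box a b)"
      by (intro convex_connected convex_Int convex_ball convex_box)
    then have "ball z e \<inter> box a b \<subseteq> D1 \<or> ball z e \<inter> box a b \<subseteq> D2"
      using connected_subset_subdomain[OF assms(1)] e by blast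
    moreover obtain y1 y2 where "y1 \<in> D1" "dist y1 z < e" "y2 \<in> D2" "dist y2 z < e"
      using z e(1) by (meson closure_approachable)
    moreover from this have "y1 \<in> ball z e \<inter> box a b" "y2 \<in> ball z e \<inter> box a b"
      using D(2) by (auto simp: dist_commute)
    ultimately show False using D(1) by blast
  qed
  moreover have "S \<subseteq> closure D1 \<union> closure D2" using cover assms(4,5) by blast
  ultimately have "closure D1 \<inter> S = {} \<or> closure D2 \<inter> S = {}"
    by (intro connected_closedD[OF assms(3)]) auto
  moreover have "x \<in> closure D2" using assms(7) by (simp add: side_def)
  ultimately have "closure D1 \<inter> S = {}" using assms(6) by blast
  then show ?thesis using cover assms(4,5) by (auto simp: side_def)
qed

text \<open>Near \<open>X\<close> the defining function increases strictly in direction \<open>n\<close>.  A nearby point off \<open>\<Gamma>\<close> can be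
moved along \<open>n\<close> or \<open>- n\<close>, according to the sign of the function, without meeting \<open>\<Gamma>\<close> until it is
inside one of the two tangent balls.  If both balls belonged to \<open>D1\<close>, then so would all points off
\<open>\<Gamma>\<close> near \<open>X\<close>, although \<open>X\<close> is in the closure of \<open>D2\<close>.\<close>
lemma not_one_sided:
  assumes sep: "separates \<Gamma> (box a b) D1 D2"
    and X: "X \<in> \<Gamma>" and f: "local_C2_equation \<Gamma> X U f" and n: "n = sgn (grad f X)" and r: "0 < r"
    and balls: "ball (X + r *\<^sub>R n) r \<inter> box a b \<subseteq> D1" "ball (X - r *\<^sub>R n) r \<inter> box a b \<subseteq> D1"
  shows False
proof -
  have D: "D1 \<inter> D2 = {}" "box a b - \<Gamma> = D1 \<union> D2" "\<Gamma> \<subseteq> box a b" "\<Gamma> \<subseteq> closure D2"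
    using sep by (simp_all add: separates_def)
  have U: "open U" "X \<in> U" "\<Gamma> \<inter> U = {x \<in> U. f x = 0}" "grad f X \<noteq> 0"
    using f by (auto simp: local_C2_equation_def)
  have nn: "norm n = 1" using U by (simp add: n norm_sgn)
  define V where "V = {x \<in> U \<inter> box a b. 0 < grad f x \<bullet> n}"
  have gX: "grad f X \<bullet> n = norm (grad f X)"
    using U by (simp add: n sgn_div_norm power2_norm_eq_inner[symmetric] power2_eq_square)
  have "open V"
  proof -
    have "continuous_on (U \<inter> box a b) (\<lambda>x. grad f x \<bullet> n)"
      using local_equation_continuous_on(2)[OF f]
      by (intro continuous_intros) (blast intro: continuous_on_subset)
    then have "open ((\<lambda>x. grad f x \<bullet> n) -` {0<..} \<inter> (U \<inter> box a b))"
      using U(1) continuous_on_open_vimage[of "U \<inter> box a b"] open_greaterThan open_box by blast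
    then show ?thesis by (simp add: V_def vimage_def Int_def conj_commute)
  qed
  moreover have "X \<in> V" using U D X gX by (auto simp: V_def)
  ultimately obtain e where e: "0 < e" "ball X e \<subseteq> V" using open_contains_ball by blast
  define d where "d = min (e / 2) r"
  have d: "0 < d" "d \<le> r" "2 * d \<le> e" using e r by (auto simp: d_def)
  have inV: "x + t *\<^sub>R n \<in> V" if "dist X x < d" "\<bar>t\<bar> \<le> d" for x t
  proof -
    have "norm (X - (x + t *\<^sub>R n)) \<le> norm (X - x) + \<bar>t\<bar>"
      using norm_triangle_ineq4[of "X - x" "t *\<^sub>R n"] nn by (simp add: algebra_simps)
    then have "x + t *\<^sub>R n \<in> ball X e" using that d by (simp add: dist_norm)
    then show ?thesis using e by blast
  qed
  have inball: "x + d *\<^sub>R n \<in> ball (X + r *\<^sub>R n) r" "x - d *\<^sub>R n \<in> ball (X - r *\<^sub>R n) r"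
    if "dist X x < d" for x
  proof -
    have e1: "X + r *\<^sub>R n - (x + d *\<^sub>R n) = (X - x) + (r - d) *\<^sub>R n"
      by (simp add: algebra_simps)
    moreover have "norm ((X - x) + (r - d) *\<^sub>R n) \<le> norm (X - x) + (r - d)"
      using norm_triangle_ineq[of "X - x" "(r - d) *\<^sub>R n"] nn d by simp
    ultimately show "x + d *\<^sub>R n \<in> ball (X + r *\<^sub>R n) r"
      using that unfolding mem_ball dist_norm e1 by linarith
    have e2: "X - r *\<^sub>R n - (x - d *\<^sub>R n) = (X - x) - (r - d) *\<^sub>R n"
      by (simp add: algebra_simps)
    moreover have "norm ((X - x) - (r - d) *\<^sub>R n) \<le> norm (X - x) + (r - d)"
      using norm_triangle_ineq4[of "X - x" "(r - d) *\<^sub>R n"] nn d by simp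
    ultimately show "x - d *\<^sub>R n \<in> ball (X - r *\<^sub>R n) r"
      using that unfolding mem_ball dist_norm e2 by linarith
  qed
  have mono: "f (x + s *\<^sub>R n) < f (x + t *\<^sub>R n)" if "dist X x < d" "- d \<le> s" "s < t" "t \<le> d" for x s t
  proof (rule DERIV_pos_imp_increasing[OF that(3)])
    fix y assume y: "s \<le> y" "y \<le> t"
    have v: "x + y *\<^sub>R n \<in> V" using inV[OF that(1), of y] y that by auto
    then have "(f has_derivative (\<lambda>v. grad f (x + y *\<^sub>R n) \<bullet> v)) (at (x + y *\<^sub>R n))"
      by (intro local_equation_has_derivative[OF f]) (simp add: V_def)
    moreover have "((\<lambda>y. x + y *\<^sub>R n) has_derivative (\<lambda>y. y *\<^sub>R n)) (at y)"
      by (auto intro!: derivative_eq_intros)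
    ultimately have "((\<lambda>y. f (x + y *\<^sub>R n)) has_derivative (\<lambda>t. grad f (x + y *\<^sub>R n) \<bullet> (t *\<^sub>R n))) (at y)"
      using has_derivative_compose[of "\<lambda>y. x + y *\<^sub>R n" "\<lambda>t. t *\<^sub>R n" y UNIV f] by blast
    then have "((\<lambda>y. f (x + y *\<^sub>R n)) has_real_derivative (grad f (x + y *\<^sub>R n) \<bullet> n)) (at y)"
      by (simp add: has_field_derivative_def mult_commute_abs)
    then show "\<exists>z. ((\<lambda>y. f (x + y *\<^sub>R n)) has_real_derivative z) (at y) \<and> 0 < z"
      using v by (auto simp: V_def)
  qed
  have "x \<notin> D2" if x: "dist X x < d" for x
  proof
    assume xD: "x \<in> D2"
    have V0: "f y \<noteq> 0 \<longleftrightarrow> y \<notin> \<Gamma>" if "y \<in> V" for y using that U(3) by (auto simp: V_def)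
    have fx: "f x \<noteq> 0" using V0[of x] inV[OF x, of 0] d xD D by auto
    define sg :: real where "sg = (if 0 < f x then 1 else - 1)"
    let ?S = "(\<lambda>t. x + (sg * t) *\<^sub>R n) ` {0..d}"
    have "connected ?S"
      by (intro connected_continuous_image continuous_intros connected_Icc)
    moreover have "?S \<subseteq> box a b"
      using inV[OF x] by (force simp: V_def sg_def)
    moreover have "?S \<inter> \<Gamma> = {}"
    proof -
      have "x + (sg * t) *\<^sub>R n \<notin> \<Gamma>" if t: "t \<in> {0..d}" for t
      proof (cases "t = 0")
        case True then show ?thesis using xD D by auto
      next
        case False
        have "f (x + (sg * t) *\<^sub>R n) \<noteq> 0"
        proof (cases "0 < f x")
          case True
          then show ?thesis using mono[OF x, of 0 t] t False d by (auto simp: sg_def)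
        next
          case neg: False
          then show ?thesis using mono[OF x, of "- t" 0] t False d fx by (auto simp: sg_def)
        qed
        then show ?thesis using V0 inV[OF x, of "sg * t"] t by (auto simp: sg_def split: if_splits)
      qed
      then show ?thesis by auto
    qed
    ultimately have "?S \<subseteq> D1 \<or> ?S \<subseteq> D2" by (rule connected_subset_subdomain[OF sep])
    moreover have "x \<in> ?S" using d by (auto intro!: image_eqI[of _ _ 0])
    moreover have e1: "x + (sg * d) *\<^sub>R n \<in> ?S" using d by auto
    moreover have "x + (sg * d) *\<^sub>R n \<in> D1"
    proof -
      have "x + (sg * d) *\<^sub>R n \<in> box a b" using \<open>?S \<subseteq> box a b\<close> e1 by blast
      then show ?thesis using inball[OF x] balls by (cases "0 < f x") (auto simp: sg_def)
    qed
    ultimately show False using xD D(1) by blast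
  qed
  moreover have "\<exists>y\<in>D2. dist y X < d"
    using X D(4) d(1) by (meson closure_approachable subsetD)
  ultimately show False by (auto simp: dist_commute)
qed

lemma tangent_balls_opposite_sides:
  assumes sep: "separates \<Gamma> (box a b) D1 D2" and surf: "closed_C2_surface \<Gamma>"
    and r: "0 < r" "disjoint_family_on (\<lambda>X. normal_segment \<Gamma> X r) \<Gamma>" and X: "X \<in> \<Gamma>"
  obtains n where "norm n = 1"
    "ball (X + r *\<^sub>R n) r \<inter> cbox a b \<subseteq> side \<Gamma> D2"
    "ball (X - r *\<^sub>R n) r \<inter> (side \<Gamma> D2 \<union> \<Gamma>) = {}"
proof -
  have D: "D1 \<inter> D2 = {}" "box a b - \<Gamma> = D1 \<union> D2" "\<Gamma> \<subseteq> box a b" "D1 \<noteq> {}"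
    using sep by (simp_all add: separates_def)
  have ne: "box a b \<noteq> {}" using D by blast
  obtain U f where f: "local_C2_equation \<Gamma> X U f"
    using surf X unfolding closed_C2_surface_def by blast
  define m where "m = sgn (grad f X)"
  have m: "unit_normal \<Gamma> X m" using f by (auto simp: unit_normal_def m_def)
  have nm: "norm m = 1" using f by (auto simp: m_def local_C2_equation_def norm_sgn)
  have avoid: "ball (X + r *\<^sub>R m) r \<inter> \<Gamma> = {}" "ball (X - r *\<^sub>R m) r \<inter> \<Gamma> = {}"
    using tangent_ball_avoids_surface[OF surf r X m]
      tangent_ball_avoids_surface[OF surf r X unit_normal_minus[OF m]] by auto
  have cases: "ball z r \<inter> box a b \<subseteq> D1 \<or> ball z r \<inter> box a b \<subseteq> D2" if "ball z r \<inter> \<Gamma> = {}" for z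
    using that by (intro connected_subset_subdomain[OF sep] convex_connected convex_Int convex_ball convex_box) auto
  have n1: "\<not> (ball (X + r *\<^sub>R m) r \<inter> box a b \<subseteq> D1 \<and> ball (X - r *\<^sub>R m) r \<inter> box a b \<subseteq> D1)"
    using not_one_sided[OF sep X f m_def r(1)] by blast
  have n2: "\<not> (ball (X + r *\<^sub>R m) r \<inter> box a b \<subseteq> D2 \<and> ball (X - r *\<^sub>R m) r \<inter> box a b \<subseteq> D2)"
    using not_one_sided[OF separates_swap[OF sep] X f m_def r(1)] by blast
  have "\<exists>n. (n = m \<or> n = - m) \<and> ball (X + r *\<^sub>R n) r \<inter> box a b \<subseteq> D2 \<and> ball (X - r *\<^sub>R n) r \<inter> box a b \<subseteq> D1"
    using cases[OF avoid(1)] cases[OF avoid(2)] n1 n2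
    by (metis (no_types, lifting) diff_minus_eq_add minus_minus scaleR_minus_right uminus_add_conv_diff add.commute)
  then obtain n where n: "n = m \<or> n = - m"
    "ball (X + r *\<^sub>R n) r \<inter> box a b \<subseteq> D2" "ball (X - r *\<^sub>R n) r \<inter> box a b \<subseteq> D1" by blast
  have av: "ball (X + r *\<^sub>R n) r \<inter> \<Gamma> = {}" "ball (X - r *\<^sub>R n) r \<inter> \<Gamma> = {}"
    using n(1) avoid by auto
  have "ball (X + r *\<^sub>R n) r \<inter> cbox a b \<subseteq> closure (ball (X + r *\<^sub>R n) r \<inter> box a b)"
    using open_Int_closure_subset[of "ball (X + r *\<^sub>R n) r" "box a b"] closure_box[OF ne] by simp
  also have "\<dots> \<subseteq> closure D2" using n(2) by (rule closure_mono)
  finally have 1: "ball (X + r *\<^sub>R n) r \<inter> cbox a b \<subseteq> side \<Gamma> D2" using av by (auto simp: side_def)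
  have "ball (X - r *\<^sub>R n) r \<inter> D2 = {}" using n(3) D by blast
  then have "ball (X - r *\<^sub>R n) r \<inter> closure D2 = {}" by (simp add: open_Int_closure_eq_empty)
  then have 2: "ball (X - r *\<^sub>R n) r \<inter> (side \<Gamma> D2 \<union> \<Gamma>) = {}" using av by (auto simp: side_def)
  show ?thesis using that[of n] 1 2 n(1) nm by auto
qed

text \<open>The heart of the proof.  The numbers \<open>\<epsilon> i\<close> give the orientation of the three edges at the vertex \<open>Z\<close>,
and \<open>l\<close> is the distance up to which they are followed.  If \<open>X \<in> \<Gamma>\<close> is within
\<open>l / 100\<close> of \<open>Z\<close>, the points at distance \<open>l\<close> on the edges are outside the ball tangent at \<open>X\<close> from the side
\<open>D1\<close>, which forces \<open>\<epsilon> i * n $ i \<ge> - 7 / 100\<close> for the unit normal \<open>n\<close> at \<open>X\<close>; hence \<open>n\<close> has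
a substantial component along the diagonal of the octant, and the ball tangent from the side \<open>D2\<close>
contains a ball of radius \<open>l / 10\<close> around the midpoint of the cube with edge \<open>l\<close> at \<open>Z\<close>.\<close>
lemma ball_at_vertex:
  assumes sep: "separates \<Gamma> (box a b) D1 D2" and surf: "closed_C2_surface \<Gamma>"
    and r: "disjoint_family_on (\<lambda>X. normal_segment \<Gamma> X r) \<Gamma>"
    and l: "0 < l" "10 * l \<le> r"
    and T: "convex T" "T \<subseteq> cbox a b"
    and corner: "\<And>i. \<epsilon> i = 1 \<or> \<epsilon> i = (- 1 :: real)"
      "\<And>y. (\<And>i. 0 \<le> \<epsilon> i * (y $ i - Z $ i) \<and> \<epsilon> i * (y $ i - Z $ i) \<le> l) \<Longrightarrow> y \<in> T"
    and sides: "Z \<in> side \<Gamma> D2 \<union> \<Gamma>" "\<And>i. Z + axis i (\<epsilon> i * l) \<in> side \<Gamma> D2 \<union> \<Gamma>"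
  obtains Y where "ball Y (3 / 1000 * l) \<subseteq> T \<inter> side \<Gamma> D2"
proof -
  have r0: "0 < r" using l by linarith
  have norm3: "norm x \<le> c" if "\<And>i. \<bar>x $ i\<bar> \<le> b" "3 * b\<^sup>2 \<le> c\<^sup>2" "0 \<le> c" for x :: point and b c
  proof -
    have "(norm x)\<^sup>2 \<le> c\<^sup>2" using norm_sq_le_of_components[OF that(1)] that(2) by (rule order_trans)
    then show ?thesis using that(3) by (rule power2_le_imp_le)
  qed
  have coord: "\<bar>\<epsilon> i * (y $ i - Z $ i) - t\<bar> < d" if "y \<in> ball (\<chi> i. Z $ i + \<epsilon> i * t) d" for y i t d
  proof -
    have "\<bar>((\<chi> i. Z $ i + \<epsilon> i * t) - y) $ i\<bar> < d"
      using that component_le_norm_cart[of "(\<chi> i. Z $ i + \<epsilon> i * t) - y" i] by (simp add: dist_norm)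
    then show ?thesis using corner(1)[of i] by auto
  qed
  show ?thesis
  proof (cases "ball Z (l / 100) \<inter> \<Gamma> = {}")
    case True
    \<comment> \<open>chosen so that the ball of radius \<open>3 / 1000 * l\<close> around it is in the octant and within \<open>l / 100\<close> of \<open>Z\<close>\<close>
    let ?Y = "(\<chi> i. Z $ i + \<epsilon> i * (4 / 1000 * l)) :: point"
    have ZT: "Z \<in> T" using l by (intro corner(2)) auto
    have "Z \<in> ball Z (l / 100)" using l by simp
    then have "Z \<in> side \<Gamma> D2" using True sides(1) by blast
    moreover have "connected (T \<inter> ball Z (l / 100))"
      using T(1) by (intro convex_connected convex_Int convex_ball)
    ultimately have S: "T \<inter> ball Z (l / 100) \<subseteq> side \<Gamma> D2"
      using connected_subset_side[OF sep _ _ _ _ , of "T \<inter> ball Z (l / 100)" Z] surf T(2) True ZT l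
      by (auto simp: closed_C2_surface_def)
    have "y \<in> T \<inter> ball Z (l / 100)" if y: "y \<in> ball ?Y (3 / 1000 * l)" for y
    proof -
      have c: "1 / 1000 * l \<le> \<epsilon> i * (y $ i - Z $ i)" "\<epsilon> i * (y $ i - Z $ i) \<le> 7 / 1000 * l" for i
        using coord[OF y, of i] by linarith+
      have "y \<in> T" 
      proof (rule corner(2))
        show "0 \<le> \<epsilon> i * (y $ i - Z $ i) \<and> \<epsilon> i * (y $ i - Z $ i) \<le> l" for i
          using c[of i] l(1) by linarith
      qed
      moreover have "norm (Z - ?Y) \<le> 7 / 1000 * l"
      proof (rule norm3)
        show "\<bar>(Z - ?Y) $ i\<bar> \<le> 4 / 1000 * l" for i
          using corner(1)[of i] l(1) by auto
      qed (use l in \<open>auto simp: power2_eq_square\<close>)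
      then have "norm (Z - y) < l / 100"
        using y norm_triangle_ineq[of "Z - ?Y" "?Y - y"] by (simp add: dist_norm)
      then have "y \<in> ball Z (l / 100)" by (simp add: dist_norm)
      ultimately show ?thesis by blast
    qed
    then show ?thesis using that[of ?Y] S by blast
  next
    case False
    then obtain X where X: "X \<in> \<Gamma>" "norm (Z - X) < l / 100" by (auto simp: dist_norm)
    obtain n where n: "norm n = 1" "ball (X + r *\<^sub>R n) r \<inter> cbox a b \<subseteq> side \<Gamma> D2"
      "ball (X - r *\<^sub>R n) r \<inter> (side \<Gamma> D2 \<union> \<Gamma>) = {}"
      using tangent_balls_opposite_sides[OF sep surf r0 r X(1)] by blast
    have inner_le: "\<bar>x \<bullet> n\<bar> \<le> norm x" for x using Cauchy_Schwarz_ineq2[of x n] n(1) by simp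
    have nn: "n \<bullet> n = 1" using n(1) by (simp add: norm_eq_1)
    have expand: "(norm (x - s *\<^sub>R n))\<^sup>2 = (norm x)\<^sup>2 - 2 * s * (x \<bullet> n) + s\<^sup>2" for x s
      unfolding power2_norm_eq_inner
      by (simp add: inner_diff_left inner_diff_right inner_commute[of n x] nn power2_eq_square algebra_simps)
    have zx: "\<bar>(Z - X) \<bullet> n\<bar> < l / 100" using inner_le[of "Z - X"] X(2) by linarith
    have lower: "- (7 / 100) \<le> \<epsilon> i * n $ i" for i
    proof -
      define w where "w = Z + axis i (\<epsilon> i * l) - X"
      have "Z + axis i (\<epsilon> i * l) \<notin> ball (X - r *\<^sub>R n) r" using sides(2)[of i] n(3) by blast
      moreover have "X - r *\<^sub>R n - (Z + axis i (\<epsilon> i * l)) = - (w - (- r) *\<^sub>R n)"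
        by (simp add: w_def)
      ultimately have "r \<le> norm (w - (- r) *\<^sub>R n)" by (simp only: mem_ball dist_norm norm_minus_cancel not_less)
      then have "r\<^sup>2 \<le> (norm (w - (- r) *\<^sub>R n))\<^sup>2" using r0 by (intro power_mono) auto
      then have 1: "0 \<le> (norm w)\<^sup>2 + 2 * r * (w \<bullet> n)" unfolding expand by simp
      have "norm w \<le> norm (Z - X) + norm (axis i (\<epsilon> i * l))"
        using norm_triangle_ineq[of "Z - X" "axis i (\<epsilon> i * l)"] by (simp add: w_def algebra_simps)
      also have "\<dots> \<le> l / 100 + l" using X(2) corner(1)[of i] l by (auto simp: norm_axis_real)
      finally have "norm w \<le> 101 / 100 * l" by simp
      then have "(norm w)\<^sup>2 \<le> (101 / 100 * l)\<^sup>2" by (intro power_mono) auto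
      then have 2: "(norm w)\<^sup>2 \<le> 11 / 10 * (l * l)" using l(1) by (simp add: power2_eq_square) (smt (verit) mult_pos_pos)
      have 3: "- (11 / 200) * l \<le> w \<bullet> n"
      proof (rule ccontr)
        assume "\<not> ?thesis"
        then have lt: "w \<bullet> n < - (11 / 200) * l" by simp
        have "2 * r * (w \<bullet> n) < 2 * r * (- (11 / 200) * l)" using lt r0 by (intro mult_strict_left_mono) auto
        also have "\<dots> \<le> 2 * (10 * l) * (- (11 / 200) * l)"
          using l by (intro mult_right_mono_neg) auto
        finally show False using 1 2 by simp
      qed
      have "w \<bullet> n = (Z - X) \<bullet> n + l * (\<epsilon> i * n $ i)"
        by (simp add: w_def inner_add_left inner_diff_left inner_axis' algebra_simps)
      then have "l * (- (7 / 100)) \<le> l * (\<epsilon> i * n $ i)" using 3 zx l(1) by linarith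
      then show ?thesis using l(1) by (simp only: mult_le_cancel_left_pos)
    qed
    \<comment> \<open>shifted by \<open>7 / 100\<close>, the components are nonnegative, and a small sum would contradict \<open>norm n = 1\<close>\<close>
    have sum: "43 / 100 \<le> (\<Sum>i\<in>UNIV. \<epsilon> i * n $ i)"
    proof (rule ccontr)
      define k where "k i = \<epsilon> i * n $ i + 7 / 100" for i
      have k0: "0 \<le> k i" for i using lower[of i] by (simp add: k_def)
      assume "\<not> ?thesis"
      then have s: "k 1 + k 2 + k 3 < 64 / 100" by (simp add: k_def sum_3)
      have sq: "(\<epsilon> i)\<^sup>2 = 1" for i using corner(1)[of i] by auto
      have ni: "(n $ i)\<^sup>2 = (k i - 7 / 100)\<^sup>2" for i by (simp add: k_def power_mult_distrib sq)
      have "1 = (\<Sum>i\<in>UNIV. (n $ i)\<^sup>2)" using n(1) by (simp add: norm_vec_def L2_set_def)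
      then have "1 = (k 1 - 7 / 100)\<^sup>2 + (k 2 - 7 / 100)\<^sup>2 + (k 3 - 7 / 100)\<^sup>2"
        by (simp add: ni sum_3)
      moreover have "(k 1 + k 2 + k 3)\<^sup>2 \<le> (64 / 100)\<^sup>2" using s k0[of 1] k0[of 2] k0[of 3]
        by (intro power_mono) auto
      moreover have "0 \<le> k 1 * k 2" "0 \<le> k 1 * k 3" "0 \<le> k 2 * k 3" using k0 by auto
      ultimately show False using k0[of 1] k0[of 2] k0[of 3]
        by (simp add: power2_eq_square algebra_simps)
    qed
    let ?Y = "(\<chi> i. Z $ i + \<epsilon> i * (1 / 2 * l)) :: point"
    have "y \<in> T \<inter> side \<Gamma> D2" if y: "y \<in> ball ?Y (1 / 10 * l)" for y
    proof -
      have c: "4 / 10 * l \<le> \<epsilon> i * (y $ i - Z $ i)" "\<epsilon> i * (y $ i - Z $ i) \<le> 6 / 10 * l" for i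
        using coord[OF y, of i] by linarith+
      have yT: "y \<in> T"
      proof (rule corner(2))
        show "0 \<le> \<epsilon> i * (y $ i - Z $ i) \<and> \<epsilon> i * (y $ i - Z $ i) \<le> l" for i
          using c[of i] l(1) by linarith
      qed
      have yY: "norm (y - ?Y) < 1 / 10 * l" using y by (simp add: dist_norm norm_minus_commute)
      have YZ: "norm (?Y - Z) \<le> 87 / 100 * l"
      proof (rule norm3)
        show "\<bar>(?Y - Z) $ i\<bar> \<le> 1 / 2 * l" for i using corner(1)[of i] l by auto
      qed (use l in \<open>auto simp: power2_eq_square\<close>)
      have dec: "y - X = (y - ?Y) + (?Y - Z) + (Z - X)" by simp
      have "norm (y - X) \<le> norm (y - ?Y) + norm (?Y - Z) + norm (Z - X)"
        unfolding dec using norm_triangle_ineq[of "y - ?Y" "?Y - Z"]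
          norm_triangle_ineq[of "(y - ?Y) + (?Y - Z)" "Z - X"] by linarith
      then have "norm (y - X) \<le> 98 / 100 * l" using yY YZ X(2) by linarith
      then have "(norm (y - X))\<^sup>2 \<le> (98 / 100 * l)\<^sup>2" by (intro power_mono) auto
      then have 1: "(norm (y - X))\<^sup>2 \<le> l * l" using l(1) by (simp add: power2_eq_square) (smt (verit) mult_pos_pos)
      have "(?Y - Z) \<bullet> n = 1 / 2 * l * (\<Sum>i\<in>UNIV. \<epsilon> i * n $ i)"
        by (simp add: inner_vec_def sum_distrib_left mult_ac)
      also have "\<dots> \<ge> 1 / 2 * l * (43 / 100)" using sum l by (intro mult_left_mono) auto
      finally have "1 / 10 * l \<le> (y - X) \<bullet> n"
        using inner_le[of "y - ?Y"] yY zx unfolding dec inner_add_left by linarith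
      then have "2 * (10 * l) * (1 / 10 * l) \<le> 2 * r * ((y - X) \<bullet> n)"
        using l by (intro mult_mono) auto
      then have "(norm (y - X - r *\<^sub>R n))\<^sup>2 < r\<^sup>2"
      proof -
        have "0 < l * l" using l(1) by simp
        then have "l * l < 2 * (10 * l) * (1 / 10 * l)" by simp
        then show ?thesis
          unfolding expand using 1 \<open>2 * (10 * l) * (1 / 10 * l) \<le> 2 * r * ((y - X) \<bullet> n)\<close> by linarith
      qed
      then have "norm (y - X - r *\<^sub>R n) < r" by (rule power2_less_imp_less) (use r0 in simp)
      moreover have e: "X + r *\<^sub>R n - y = - (y - X - r *\<^sub>R n)" by simp
      ultimately have "y \<in> ball (X + r *\<^sub>R n) r" unfolding mem_ball dist_norm e norm_minus_cancel by simp
      then show ?thesis using n(2) yT T(2) by blast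
    qed
    moreover have "ball ?Y (3 / 1000 * l) \<subseteq> ball ?Y (1 / 10 * l)" using l by (intro subset_ball) simp
    ultimately show ?thesis using that[of ?Y] by blast
  qed
qed

section \<open>Edges and vertex labels of a cuboid\<close>

text \<open>The other end of the edge of \<open>cbox u v\<close> that starts in the vertex \<open>Z\<close> and is parallel to the
\<open>i\<close>-th axis.\<close>
definition opposite_end :: "point \<Rightarrow> point \<Rightarrow> point \<Rightarrow> 3 \<Rightarrow> point" where
  "opposite_end u v Z i = Z + axis i (u $ i + v $ i - 2 * Z $ i)"

definition box_vertex :: "point \<Rightarrow> point \<Rightarrow> point \<Rightarrow> bool" where
  "box_vertex u v Z \<longleftrightarrow> (\<forall>i. u $ i < v $ i) \<and> (\<forall>i. Z $ i = u $ i \<or> Z $ i = v $ i)"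

lemma opposite_end_nth:
  "opposite_end u v Z i $ j = (if j = i then u $ i + v $ i - Z $ i else Z $ j)"
  by (simp add: opposite_end_def axis_def)

lemma box_vertex_opposite_end:
  assumes "box_vertex u v Z" shows "box_vertex u v (opposite_end u v Z i)"
  using assms unfolding box_vertex_def opposite_end_nth by (metis add_diff_cancel_left' add_diff_cancel_right')

lemma box_vertex_mem: "box_vertex u v Z \<Longrightarrow> Z \<in> cbox u v"
  unfolding box_vertex_def mem_box_cart by (metis less_imp_le order_refl)

lemma dist_opposite_end:
  assumes "box_vertex u v Z" shows "dist Z (opposite_end u v Z i) = v $ i - u $ i"
proof -
  have "u $ i < v $ i" "Z $ i = u $ i \<or> Z $ i = v $ i" using assms by (auto simp: box_vertex_def)
  then show ?thesis by (auto simp: opposite_end_def dist_norm norm_axis_real)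
qed

text \<open>The edge is the intersection of two faces, each cut out by a supporting hyperplane that fixes one
of the other two coordinates.\<close>
lemma box_edge:
  assumes Z: "box_vertex u v Z"
  shows "closed_segment Z (opposite_end u v Z i) edge_of cbox u v"
proof -
  define W where "W = opposite_end u v Z i"
  have lt: "u $ j < v $ j" and Zj: "Z $ j = u $ j \<or> Z $ j = v $ j" for j
    using Z by (auto simp: box_vertex_def)
  have face: "(cbox u v \<inter> {x. x $ j = Z $ j}) face_of cbox u v" for j
    using Zj[of j]
  proof
    assume "Z $ j = u $ j"
    then show ?thesis
      using face_of_Int_supporting_hyperplane_ge[of "cbox u v" "u $ j" "axis j 1"]
      by (simp add: inner_axis' mem_box_cart)
  next
    assume "Z $ j = v $ j"
    then show ?thesis
      using face_of_Int_supporting_hyperplane_le[of "cbox u v" "axis j 1" "v $ j"]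
      by (simp add: inner_axis' mem_box_cart)
  qed
  have "closed_segment Z W = (\<Inter>j\<in>- {i}. cbox u v \<inter> {x. x $ j = Z $ j})" (is "_ = ?F")
  proof
    show "closed_segment Z W \<subseteq> ?F"
    proof
      fix x assume x: "x \<in> closed_segment Z W"
      have "closed_segment Z W \<subseteq> cbox u v"
        using box_vertex_mem[OF Z] box_vertex_mem[OF box_vertex_opposite_end[OF Z]]
        by (intro closed_segment_subset) (auto simp: W_def)
      moreover have "x $ j = Z $ j" if "j \<noteq> i" for j
      proof -
        obtain t where "x = (1 - t) *\<^sub>R Z + t *\<^sub>R W" using x by (auto simp: in_segment)
        then have "x $ j = (1 - t) * Z $ j + t * W $ j" by simp
        then show ?thesis using that by (simp add: W_def opposite_end_nth algebra_simps)
      qed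
      ultimately show "x \<in> ?F" using x by auto
    qed
    show "?F \<subseteq> closed_segment Z W"
    proof
      fix x assume x: "x \<in> ?F"
      \<comment> \<open>addition in the index type is modulo 3, so \<open>i + 1\<close> is one of the other two directions\<close>
      have "i + 1 \<noteq> i" by simp
      then have "x \<in> cbox u v" using x by blast
      then have xi: "u $ i \<le> x $ i" "x $ i \<le> v $ i" by (auto simp: mem_box_cart)
      define t where "t = (x $ i - Z $ i) / (u $ i + v $ i - 2 * Z $ i)"
      have t: "0 \<le> t" "t \<le> 1" "x $ i = Z $ i + t * (u $ i + v $ i - 2 * Z $ i)"
        using Zj[of i] lt[of i] xi by (auto simp: t_def field_simps)
      have "x = (1 - t) *\<^sub>R Z + t *\<^sub>R W"
      proof (simp add: vec_eq_iff W_def opposite_end_nth, intro allI conjI impI)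
        show "x $ i = (1 - t) * Z $ i + t * (u $ i + v $ i - Z $ i)"
          using t(3) by (simp add: algebra_simps)
        show "x $ j = (1 - t) * Z $ j + t * Z $ j" if "j \<noteq> i" for j
        proof -
          have "x $ j = Z $ j" using x that by blast
          then show ?thesis by (simp add: algebra_simps)
        qed
      qed
      then show "x \<in> closed_segment Z W" using t by (auto simp: in_segment)
    qed
  qed
  moreover have "?F face_of cbox u v"
  proof (rule face_of_Inter)
    have "i + 1 \<noteq> i" by simp
    then show "(\<lambda>j. cbox u v \<inter> {x. x $ j = Z $ j}) ` (- {i}) \<noteq> {}" by blast
  qed (use face in auto)
  moreover have "Z \<noteq> W" using dist_opposite_end[OF Z, of i] lt[of i] by (auto simp: W_def)
  ultimately have "closed_segment Z W face_of cbox u v" "Z \<noteq> W" by simp_all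
  moreover from this have "aff_dim (closed_segment Z W) = 1"
    by (simp add: segment_convex_hull aff_dim_convex_hull)
  ultimately show ?thesis unfolding edge_of_def W_def by blast
qed

text \<open>If \<open>P\<close> and \<open>Q\<close> differed in two coordinates, exchanging one of them would give two further points of
the box with the same midpoint; since edges are faces, these would have to lie on the segment.\<close>
lemma box_edge_ends:
  assumes e: "closed_segment P Q edge_of cbox u v" and P: "box_vertex u v P" and Q: "box_vertex u v Q"
  shows "\<exists>i. Q = opposite_end u v P i"
proof -
  have "P \<noteq> Q" using e by (auto simp: edge_of_def segment_convex_hull aff_dim_convex_hull)
  then obtain i where i: "P $ i \<noteq> Q $ i" by (auto simp: vec_eq_iff)
  have "P $ j = Q $ j" if ji: "j \<noteq> i" for j
  proof (rule ccontr)
    assume j: "P $ j \<noteq> Q $ j"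
    define P' where "P' = (\<chi> m. if m = i then Q $ m else P $ m)"
    define Q' where "Q' = (\<chi> m. if m = i then P $ m else Q $ m)"
    have "P' \<in> cbox u v" "Q' \<in> cbox u v"
      using box_vertex_mem[OF P] box_vertex_mem[OF Q] by (auto simp: P'_def Q'_def mem_box_cart)
    moreover have "midpoint P Q \<in> closed_segment P Q" by simp
    moreover have "midpoint P Q = midpoint P' Q'"
      by (simp add: midpoint_def P'_def Q'_def vec_eq_iff)
    moreover have "P' \<noteq> Q'" using j ji by (auto simp: P'_def Q'_def vec_eq_iff)
    ultimately have "P' \<in> closed_segment P Q"
      using e unfolding edge_of_def face_of_def by (metis midpoint_in_open_segment)
    then obtain t where t: "P' = (1 - t) *\<^sub>R P + t *\<^sub>R Q" unfolding in_segment by blast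
    have *: "P' $ m = P $ m + t * (Q $ m - P $ m)" for m
      unfolding t by (simp add: algebra_simps)
    have "(t - 1) * (Q $ i - P $ i) = 0" using *[of i] by (simp add: P'_def algebra_simps)
    then have "t = 1" using i by simp
    moreover have "t = 0" using *[of j] j ji by (simp add: P'_def)
    ultimately show False by simp
  qed
  moreover have "Q $ i = u $ i + v $ i - P $ i"
    using i P Q by (auto simp: box_vertex_def) (metis add.commute add_diff_cancel_left')+
  ultimately show ?thesis
    by (intro exI[of _ i]) (auto simp: vec_eq_iff opposite_end_nth)
qed

text \<open>The adjacency of the labels: \<open>z - 1\<close> read in binary gives the position of vertex \<open>z\<close>, and adjacent
labels differ in one binary digit.\<close>
definition cube_neighbours :: "nat \<Rightarrow> nat set" where
  "cube_neighbours z =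
     [{2, 3, 5}, {1, 4, 6}, {1, 4, 7}, {2, 3, 8}, {1, 6, 7}, {2, 5, 8}, {3, 5, 8}, {4, 6, 7}] ! (z - 1)"

lemma one_to_eight: "{1..8::nat} = {1, 2, 3, 4, 5, 6, 7, 8}"
  by (rule set_eqI) (simp, presburger)

lemma cube_neighbours_subset: "z \<in> {1..8} \<Longrightarrow> cube_neighbours z \<subseteq> {1..8}"
  unfolding one_to_eight by (auto simp: cube_neighbours_def)

lemma labelled_box:
  assumes lab: "vertex_labelling (cbox u v) A" and lt: "\<And>i. u $ i < v $ i"
  shows "z \<in> {1..8} \<Longrightarrow> box_vertex u v (A z)"
    and "z \<in> {1..8} \<Longrightarrow> range (opposite_end u v (A z)) = A ` cube_neighbours z"
    and "inj_on A {1..8}"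
proof -
  obtain i j k r s t where ijk: "distinct [i, j, k]" and rst: "r \<noteq> 0" "s \<noteq> 0" "t \<noteq> 0"
    and A2: "A 2 = A 1 + axis i r" and A3: "A 3 = A 1 + axis j s"
    and A4: "A 4 = A 1 + axis i r + axis j s"
    and Am: "\<forall>m\<in>{1..4}. A (m + 4) = A m + axis k t"
    and hull: "cbox u v = convex hull (A ` {1..8})"
    using lab unfolding vertex_labelling_def by blast
  define P where "P = A 1"
  have A5: "A 5 = P + axis k t" using Am[rule_format, of 1] by (simp add: P_def)
  have A6: "A 6 = P + axis i r + axis k t" using Am[rule_format, of 2] A2 by (simp add: P_def)
  have A7: "A 7 = P + axis j s + axis k t" using Am[rule_format, of 3] A3 by (simp add: P_def)
  have A8: "A 8 = P + axis i r + axis j s + axis k t" using Am[rule_format, of 4] A4 by (simp add: P_def)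
  note A = P_def[symmetric] A2[folded P_def] A3[folded P_def] A4[folded P_def] A5 A6 A7 A8
  have ne: "i \<noteq> j" "i \<noteq> k" "j \<noteq> k" "j \<noteq> i" "k \<noteq> i" "k \<noteq> j" using ijk by auto
  have UN: "(UNIV :: 3 set) = {i, j, k}"
    using ijk by (intro card_subset_eq[symmetric]) auto
  have all3: "(\<forall>m. R m) \<longleftrightarrow> R i \<and> R j \<and> R k" for R :: "3 \<Rightarrow> bool"
    using UN by (metis UNIV_I empty_iff insert_iff)
  \<comment> \<open>\<open>P\<close> and \<open>W\<close> are antipodal vertices, so that \<open>{P $ m, W $ m} = {u $ m, v $ m}\<close> for all \<open>m\<close>\<close>
  define W where "W = P + axis i r + axis j s + axis k t"
  have Wn: "W $ i = P $ i + r" "W $ j = P $ j + s" "W $ k = P $ k + t"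
    using ijk by (auto simp: W_def axis_def)
  have PW: "A z $ m = P $ m \<or> A z $ m = W $ m" if "z \<in> {1..8}" for z m
  proof -
    have "\<forall>m. A z $ m = P $ m \<or> A z $ m = W $ m"
      unfolding all3 using that unfolding one_to_eight
      by (elim insertE emptyE) (simp_all only: A Wn, simp_all add: axis_def ne)
    then show ?thesis by blast
  qed
  define lo hi :: point where "lo = (\<chi> m. min (P $ m) (W $ m))" and "hi = (\<chi> m. max (P $ m) (W $ m))"
  have "A z \<in> cbox lo hi" if "z \<in> {1..8}" for z
    unfolding mem_box_cart lo_def hi_def using PW[OF that] by (simp) (metis max.cobounded1 max.cobounded2 min.cobounded1 min.cobounded2)
  then have "convex hull (A ` {1..8}) \<subseteq> cbox lo hi" by (intro hull_minimal) auto
  moreover have "u \<in> cbox u v" "v \<in> cbox u v" using lt by (auto simp: mem_box_cart less_imp_le)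
  ultimately have uv: "u \<in> cbox lo hi" "v \<in> cbox lo hi" using hull by auto
  have "A 1 \<in> cbox u v" "A 8 \<in> cbox u v" unfolding hull by (auto intro!: hull_inc)
  then have "P \<in> cbox u v" "W \<in> cbox u v" by (simp_all only: A W_def)
  then have opp: "P $ m = u $ m \<and> W $ m = v $ m \<or> P $ m = v $ m \<and> W $ m = u $ m" for m
    using uv lt[of m] unfolding mem_box_cart lo_def hi_def by (simp add: min_def max_def) (smt (verit))
  show 1: "box_vertex u v (A z)" if "z \<in> {1..8}" for z
    using PW[OF that] opp lt unfolding box_vertex_def by metis
  have sum: "u $ m + v $ m = P $ m + W $ m" for m using opp[of m] by auto
  have oe: "opposite_end u v Z m $ m' = (if m' = m then P $ m + W $ m - Z $ m else Z $ m')" for Z m m'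
    by (simp add: opposite_end_nth sum)
  have flips:
    "opposite_end u v (A 1) i = A 2" "opposite_end u v (A 2) i = A 1"
    "opposite_end u v (A 3) i = A 4" "opposite_end u v (A 4) i = A 3"
    "opposite_end u v (A 5) i = A 6" "opposite_end u v (A 6) i = A 5"
    "opposite_end u v (A 7) i = A 8" "opposite_end u v (A 8) i = A 7"
    "opposite_end u v (A 1) j = A 3" "opposite_end u v (A 3) j = A 1"
    "opposite_end u v (A 2) j = A 4" "opposite_end u v (A 4) j = A 2"
    "opposite_end u v (A 5) j = A 7" "opposite_end u v (A 7) j = A 5"
    "opposite_end u v (A 6) j = A 8" "opposite_end u v (A 8) j = A 6"
    "opposite_end u v (A 1) k = A 5" "opposite_end u v (A 5) k = A 1"
    "opposite_end u v (A 2) k = A 6" "opposite_end u v (A 6) k = A 2"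
    "opposite_end u v (A 3) k = A 7" "opposite_end u v (A 7) k = A 3"
    "opposite_end u v (A 4) k = A 8" "opposite_end u v (A 8) k = A 4"
    unfolding A by (simp_all add: vec_eq_iff all3 oe Wn ne axis_def)
  show "range (opposite_end u v (A z)) = A ` cube_neighbours z" if "z \<in> {1..8}" for z
    using that unfolding one_to_eight UN
    by (elim insertE emptyE)
       (simp_all add: cube_neighbours_def flips insert_commute del: One_nat_def)
  \<comment> \<open>the label is recovered from the coordinates in which the vertex differs from \<open>P\<close>\<close>
  define code :: "point \<Rightarrow> nat" where
    "code x = 1 + (if x $ i = P $ i then 0 else 1) + (if x $ j = P $ j then 0 else 2)
       + (if x $ k = P $ k then 0 else 4)" for x
  have "code (A z) = z" if "z \<in> {1..8}" for z
    using that unfolding one_to_eight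
    by (elim insertE emptyE) (simp_all only: A code_def, simp_all add: axis_def ne rst)
  then show "inj_on A {1..8}" by (rule inj_on_inverseI)
qed

lemma neighbours_labelled_box:
  assumes lab: "vertex_labelling (cbox u v) A" and lt: "\<And>i. u $ i < v $ i" and z: "z \<in> {1..8}"
  shows "neighbours (cbox u v) A z = cube_neighbours z"
proof -
  note L = labelled_box[OF lab lt]
  have "closed_segment (A z) (A k) edge_of cbox u v \<longleftrightarrow> k \<in> cube_neighbours z" if k: "k \<in> {1..8}" for k
  proof
    assume "closed_segment (A z) (A k) edge_of cbox u v"
    then have "A k \<in> range (opposite_end u v (A z))"
      using box_edge_ends L(1)[OF z] L(1)[OF k] by blast
    then have "A k \<in> A ` cube_neighbours z" using L(2)[OF z] by simp
    then show "k \<in> cube_neighbours z"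
      using inj_on_image_mem_iff[OF L(3) k cube_neighbours_subset[OF z]] by simp
  next
    assume "k \<in> cube_neighbours z"
    then have "A k \<in> range (opposite_end u v (A z))" using L(2)[OF z] by simp
    then show "closed_segment (A z) (A k) edge_of cbox u v"
      using box_edge[OF L(1)[OF z]] by auto
  qed
  then show ?thesis using cube_neighbours_subset[OF z] by (auto simp: neighbours_def)
qed

text \<open>For Types I and II the vertex is the one labelled 8, for Type IV the one antipodal to the middle
\<open>c\<close> of the three vertices in \<open>T1\<close>, whose label is \<open>9 - c\<close>, and for Type V the middle \<open>d\<close> of the
four vertices in \<open>T2\<close>.  For Type III it is the vertex from which at least half of the crossed edge
is in \<open>T2\<close>.\<close>
lemma covered_element_free_vertex:
  assumes lab: "vertex_labelling (cbox u v) A" and lt: "\<And>i. u $ i < v $ i"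
    and cov: "covered_element \<Gamma> (cbox u v) A T1 T2 P Q R"
  shows "\<exists>z\<in>{1..8}. A z \<in> T2 \<and> (\<forall>k\<in>cube_neighbours z. A k \<in> T2 \<or>
     (\<exists>D \<in> \<Gamma> \<inter> closed_segment (A z) (A k). 1 / 2 * dist (A z) (A k) \<le> dist (A z) D))"
proof -
  note N = neighbours_labelled_box[OF lab lt]
  let ?goal = "\<exists>z\<in>{1..8}. A z \<in> T2 \<and> (\<forall>k\<in>cube_neighbours z. A k \<in> T2 \<or>
     (\<exists>D \<in> \<Gamma> \<inter> closed_segment (A z) (A k). 1 / 2 * dist (A z) (A k) \<le> dist (A z) D))"
  have free: ?goal if "vertex_split A T1 T2 V" "z \<in> {1..8}" "insert z (cube_neighbours z) \<inter> V = {}" for V z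
  proof -
    have "A k \<in> T2" if "k \<in> {1..8}" "k \<notin> V" for k
      using that \<open>vertex_split A T1 T2 V\<close> unfolding vertex_split_def by blast
    then show ?thesis using that(2,3) cube_neighbours_subset[OF that(2)] by blast
  qed
  have half: ?goal if "vertex_split A T1 T2 {1, 3, 5, 7}" "z \<in> {1..8}" "z \<notin> {1, 3, 5, 7}"
      "cube_neighbours z - {m} \<subseteq> {2, 4, 6, 8}"
      "D \<in> \<Gamma>" "D \<in> closed_segment (A z) (A m)" "1 / 2 * dist (A z) (A m) \<le> dist (A z) D" for z m D
  proof -
    have T2: "A k \<in> T2" if "k \<in> {1..8}" "k \<notin> {1, 3, 5, 7}" for k
      using that \<open>vertex_split A T1 T2 {1, 3, 5, 7}\<close> unfolding vertex_split_def by blast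
    have "A k \<in> T2" if "k \<in> cube_neighbours z" "k \<noteq> m" for k
    proof (rule T2)
      have "k \<in> {2, 4, 6, 8}" using that \<open>cube_neighbours z - {m} \<subseteq> {2, 4, 6, 8}\<close> by blast
      then show "k \<in> {1..8}" "k \<notin> {1, 3, 5, 7}" by auto
    qed
    then show ?thesis using T2[OF that(2,3)] that(2,5,6,7) by blast
  qed
  consider "type_I \<Gamma> (cbox u v) A T1 T2" | "type_II \<Gamma> (cbox u v) A T1 T2"
    | "type_IV \<Gamma> (cbox u v) A T1 T2" | "type_V \<Gamma> (cbox u v) A T1 T2"
    | D1 D2 D3 D4 where "type_III \<Gamma> (cbox u v) A T1 T2 D1 D2 D3 D4"
      "dist (A 4) D4 \<ge> 1/2 * dist (A 4) (A 3) \<or> dist (A 2) D1 \<ge> 1/2 * dist (A 2) (A 1) \<or>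
         dist (A 6) D2 \<ge> 1/2 * dist (A 6) (A 5) \<or> dist (A 8) D3 \<ge> 1/2 * dist (A 8) (A 7)"
    using cov unfolding covered_element_def by blast
  then show ?thesis
  proof cases
    case 1
    then show ?thesis by (intro free[of "{1}" 8]) (auto simp: type_I_def cube_neighbours_def)
  next
    case 2
    then obtain m where m: "m \<in> cube_neighbours 1" "vertex_split A T1 T2 {1, m}"
      unfolding type_II_def using N[of 1] by auto
    show ?thesis by (rule free[OF m(2), of 8]) (use m(1) in \<open>auto simp: cube_neighbours_def\<close>)
  next
    case 3
    then obtain c m m' where c: "c \<in> {1..8}" "m \<in> cube_neighbours c" "m' \<in> cube_neighbours c"
      "vertex_split A T1 T2 {c, m, m'}"
      unfolding type_IV_def using N by blast
    have "insert (9 - c) (cube_neighbours (9 - c)) \<inter> insert c (cube_neighbours c) = {}"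
      using c(1) unfolding one_to_eight
      by (elim insertE emptyE) (simp_all add: cube_neighbours_def)
    then have "insert (9 - c) (cube_neighbours (9 - c)) \<inter> {c, m, m'} = {}" using c(2,3) by blast
    then show ?thesis by (intro free[OF c(4), of "9 - c"]) (use c(1) in auto)
  next
    case 4
    then obtain c d where c: "c \<in> {1..8}" "d \<in> {1..8}"
      "{1..8} - insert c (neighbours (cbox u v) A c) = insert d (neighbours (cbox u v) A d)"
      "vertex_split A T1 T2 (insert c (neighbours (cbox u v) A c))"
      unfolding type_V_def by blast
    show ?thesis by (rule free[OF c(4) c(2)]) (use c(3) N[OF c(2)] in auto)
  next
    case 5
    have D: "D1 \<in> \<Gamma>" "D2 \<in> \<Gamma>" "D3 \<in> \<Gamma>" "D4 \<in> \<Gamma>"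
      and seg: "D1 \<in> closed_segment (A 2) (A 1)" "D2 \<in> closed_segment (A 6) (A 5)"
        "D3 \<in> closed_segment (A 8) (A 7)" "D4 \<in> closed_segment (A 4) (A 3)"
      and sp: "vertex_split A T1 T2 {1, 3, 5, 7}"
      using 5(1) unfolding type_III_def edge_points_def
      by (auto simp: closed_segment_commute[of "A 2"] closed_segment_commute[of "A 6"]
          closed_segment_commute[of "A 8"] closed_segment_commute[of "A 4"])
    show ?thesis
      using 5(2) half[OF sp _ _ _ D(4) seg(4)] half[OF sp _ _ _ D(1) seg(1)]
        half[OF sp _ _ _ D(2) seg(2)] half[OF sp _ _ _ D(3) seg(3)]
      by (auto simp: cube_neighbours_def)
  qed
qed

text \<open>Were \<open>W\<close> off this side and off \<open>\<Gamma>\<close>, then \<open>\<Gamma>\<close> would meet the segment between \<open>P\<close> and \<open>W\<close>.  In the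
first case it would also meet the segment between \<open>W\<close> and \<open>Q\<close>, at the same point since an edge is
met only once, so this point would be \<open>W\<close>; in the second case the only point of \<open>\<Gamma>\<close> on
the edge is at least as far from \<open>P\<close> as \<open>W\<close>, so again it would be \<open>W\<close>.\<close>
lemma edge_part_on_side:
  assumes sep: "separates \<Gamma> (box a b) D1 D2" and cpt: "compact \<Gamma>"
    and P: "P \<in> side \<Gamma> D2" and sub: "closed_segment P Q \<subseteq> cbox a b"
    and once: "\<And>X Y. X \<in> \<Gamma> \<inter> closed_segment P Q \<Longrightarrow> Y \<in> \<Gamma> \<inter> closed_segment P Q \<Longrightarrow> X = Y"
    and W: "W \<in> closed_segment P Q"
    and far: "Q \<in> side \<Gamma> D2 \<or> (\<exists>D \<in> \<Gamma> \<inter> closed_segment P Q. dist P W \<le> dist P D)"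
  shows "W \<in> side \<Gamma> D2 \<union> \<Gamma>"
proof (rule ccontr)
  assume no: "\<not> ?thesis"
  have sub2: "closed_segment P W \<subseteq> closed_segment P Q" "closed_segment W Q \<subseteq> closed_segment P Q"
    using W by (auto simp: subset_closed_segment)
  have "closed_segment P W \<inter> \<Gamma> \<noteq> {}"
    using connected_subset_side[OF sep cpt _ _ _ _ P, of "closed_segment P W"] sub sub2 no by auto
  then obtain X where X: "X \<in> \<Gamma>" "X \<in> closed_segment P W" by blast
  have dX: "dist P W = dist P X + dist X W" using X(2) by (simp add: between_mem_segment[symmetric] between)
  from far show False
  proof
    assume Q: "Q \<in> side \<Gamma> D2"
    have "closed_segment W Q \<inter> \<Gamma> \<noteq> {}"
      using connected_subset_side[OF sep cpt _ _ _ _ Q, of "closed_segment W Q"] sub sub2 no by auto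
    then have X': "X \<in> closed_segment W Q" using once X sub2 by blast
    have "dist W Q = dist W X + dist X Q" using X' by (simp add: between_mem_segment[symmetric] between)
    moreover have "dist P Q = dist P W + dist W Q" using W by (simp add: between_mem_segment[symmetric] between)
    moreover have "dist P Q \<le> dist P X + dist X Q" by (rule dist_triangle)
    ultimately have "dist X W = 0" using dX zero_le_dist[of X W] dist_commute[of X W] by linarith
    then show False using no X by simp
  next
    assume "\<exists>D \<in> \<Gamma> \<inter> closed_segment P Q. dist P W \<le> dist P D"
    then have "dist P W \<le> dist P X" using once X sub2 by blast
    then have "dist X W = 0" using dX zero_le_dist[of X W] by linarith
    then show False using no X by simp
  qed
qed

section \<open>Covered elements and the extension estimate\<close>

lemma mesh_cell:
  assumes "cartesian_mesh a b \<T>" "T \<in> \<T>"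
  obtains u v where "T = cbox u v" "\<And>i. u $ i < v $ i" "T \<subseteq> cbox a b"
proof -
  obtain N :: "3 \<Rightarrow> real set" where N: "\<And>i. N i \<subseteq> {a $ i..b $ i}"
    and T: "\<T> = {cbox u v |u v. \<forall>i. u $ i \<in> N i \<and> v $ i \<in> N i \<and> u $ i < v $ i \<and>
                                  N i \<inter> {u $ i<..<v $ i} = {}}"
    using assms(1) unfolding cartesian_mesh_def by blast
  obtain u v where uv: "T = cbox u v" "\<And>i. u $ i \<in> N i" "\<And>i. v $ i \<in> N i" "\<And>i. u $ i < v $ i"
    using assms(2) unfolding T by blast
  have "a $ i \<le> u $ i \<and> v $ i \<le> b $ i" for i using N[of i] uv(2)[of i] uv(3)[of i] by auto
  then have "cbox u v \<subseteq> cbox a b" unfolding subset_iff mem_box_cart by (meson order_trans)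
  then show ?thesis using that uv by blast
qed

lemma cell_edge_lengths:
  assumes "\<And>i. u $ i < v $ i" shows "v $ i - u $ i \<in> edge_lengths (cbox u v)"
proof -
  have "box_vertex u v u" using assms by (simp add: box_vertex_def)
  from box_edge[OF this] dist_opposite_end[OF this] show ?thesis
    unfolding edge_lengths_def by (metis (mono_tags, lifting) mem_Collect_eq)
qed

lemma edge_length_le_mesh_size:
  assumes mesh: "cartesian_mesh a b \<T>" and T: "T \<in> \<T>" "x \<in> edge_lengths T"
  shows "x \<le> mesh_size \<T>"
  unfolding mesh_size_def
proof (rule cSup_upper)
  show "x \<in> (\<Union>T\<in>\<T>. edge_lengths T)" using T by blast
  have "y \<le> diameter (cbox a b)" if "y \<in> edge_lengths S" "S \<in> \<T>" for y S
  proof -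
    obtain P Q where PQ: "y = dist P Q" "closed_segment P Q edge_of S"
      using \<open>y \<in> edge_lengths S\<close> unfolding edge_lengths_def by blast
    have "S \<subseteq> cbox a b" using mesh_cell[OF mesh \<open>S \<in> \<T>\<close>] by metis
    then have "P \<in> cbox a b" "Q \<in> cbox a b" using edge_of_imp_subset[OF PQ(2)] by auto
    then show ?thesis unfolding PQ(1) by (intro diameter_bounded_bound bounded_cbox)
  qed
  then show "bdd_above (\<Union>T\<in>\<T>. edge_lengths T)" by (auto simp: bdd_above_def)
qed

text \<open>The vertex argument with edge parts of length \<open>m / 2\<close>.  It is applicable since
\<open>3 * sqrt 3 \<ge> 5\<close> makes the reach exceed \<open>5 * m = 10 * (m / 2)\<close>.\<close>
lemma covered_element_contains_ball:
  assumes mesh: "interface_mesh a b \<Gamma> \<Omega>m \<Omega>p \<T>" and T: "T \<in> \<T>" "T = cbox u v"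
    and lt: "\<And>i. u $ i < v $ i" and sub: "T \<subseteq> cbox a b"
    and lab: "vertex_labelling T A" and sep: "separates \<Gamma> (box a b) D1 D2"
    and cov: "covered_element \<Gamma> T A T1 (T \<inter> side \<Gamma> D2) P Q R"
    and m: "0 < m" "\<And>i. m \<le> v $ i - u $ i"
  obtains Y where "ball Y (3 / 2000 * m) \<subseteq> T \<inter> side \<Gamma> D2"
proof -
  have surf: "closed_C2_surface \<Gamma>" and cm: "cartesian_mesh a b \<T>"
    and reach: "mesh_size \<T> < surface_reach \<Gamma> / (3 * sqrt 3)"
    and once: "\<And>e X Y. e edge_of T \<Longrightarrow> X \<in> \<Gamma> \<inter> e \<Longrightarrow> Y \<in> \<Gamma> \<inter> e \<Longrightarrow> X = Y"
    using mesh T(1) unfolding interface_mesh_def by blast+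
  have cpt: "compact \<Gamma>" using surf by (simp add: closed_C2_surface_def)
  define l where "l = m / 2"
  have l: "0 < l" "2 * l = m" using m(1) by (simp_all add: l_def)
  have "m \<le> mesh_size \<T>"
    using m(2)[of 1] edge_length_le_mesh_size[OF cm T(1)] cell_edge_lengths[of u v 1, OF lt] T(2)
    by force
  moreover have "5 \<le> 3 * sqrt 3"
  proof -
    have "5 / 3 \<le> sqrt 3" by (rule real_le_rsqrt) (simp add: power2_eq_square)
    then show ?thesis by simp
  qed
  ultimately have "m * 5 \<le> mesh_size \<T> * (3 * sqrt 3)" using m(1) by (intro mult_mono) auto
  also have "\<dots> < surface_reach \<Gamma>" using reach by (simp add: pos_less_divide_eq)
  finally have "10 * l < surface_reach \<Gamma>" using l by simp
  then obtain r where r: "10 * l < r" "disjoint_family_on (\<lambda>X. normal_segment \<Gamma> X r) \<Gamma>"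
    by (rule reach_admissible_radius)
  obtain z where z: "z \<in> {1..8}" "A z \<in> T \<inter> side \<Gamma> D2"
    and zk: "\<And>k. k \<in> cube_neighbours z \<Longrightarrow> A k \<in> T \<inter> side \<Gamma> D2 \<or>
     (\<exists>D \<in> \<Gamma> \<inter> closed_segment (A z) (A k). 1 / 2 * dist (A z) (A k) \<le> dist (A z) D)"
    using covered_element_free_vertex[OF lab[unfolded T(2)] lt cov[unfolded T(2)]]
    unfolding T(2) by blast
  note L = labelled_box[OF lab[unfolded T(2)] lt]
  have Z: "box_vertex u v (A z)" by (rule L(1)[OF z(1)])
  define \<epsilon> :: "3 \<Rightarrow> real" where "\<epsilon> i = (if A z $ i = u $ i then 1 else - 1)" for i
  have \<epsilon>: "\<epsilon> i = 1 \<or> \<epsilon> i = - 1" for i by (simp add: \<epsilon>_def)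
  have oe: "opposite_end u v (A z) i = A z + axis i (\<epsilon> i * (v $ i - u $ i))" for i
  proof -
    have "A z $ i = u $ i \<or> A z $ i = v $ i" using Z by (simp add: box_vertex_def)
    then show ?thesis using lt[of i] by (auto simp: opposite_end_def \<epsilon>_def)
  qed
  show ?thesis
  proof (rule ball_at_vertex[OF sep surf r(2) l(1) less_imp_le[OF r(1)] _ sub \<epsilon>])
    show "convex T" by (simp add: T(2))
    show "A z \<in> side \<Gamma> D2 \<union> \<Gamma>" using z by blast
    show "y \<in> T" if y: "\<And>i. 0 \<le> \<epsilon> i * (y $ i - A z $ i) \<and> \<epsilon> i * (y $ i - A z $ i) \<le> l" for y
    proof -
      have "u $ i \<le> y $ i \<and> y $ i \<le> v $ i" for i
      proof -
        have "A z $ i = u $ i \<or> A z $ i = v $ i" using Z by (simp add: box_vertex_def)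
        then show ?thesis
          using y[of i] m(2)[of i] l lt[of i] by (auto simp: \<epsilon>_def split: if_splits)
      qed
      then show ?thesis unfolding T(2) mem_box_cart by blast
    qed
    show "A z + axis i (\<epsilon> i * l) \<in> side \<Gamma> D2 \<union> \<Gamma>" for i
    proof -
      define W where "W = A z + axis i (\<epsilon> i * l)"
      obtain k where k: "k \<in> cube_neighbours z" "opposite_end u v (A z) i = A k"
        using L(2)[OF z(1)] by (metis imageE rangeI)
      have e: "closed_segment (A z) (A k) edge_of T"
        using box_edge[OF Z, of i] by (simp add: k(2) T(2))
      have len: "dist (A z) (A k) = v $ i - u $ i" using dist_opposite_end[OF Z, of i] by (simp add: k(2))
      have dW: "dist (A z) W = l" using \<epsilon>[of i] l by (auto simp: W_def dist_norm norm_axis_real)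
      define t where "t = l / (v $ i - u $ i)"
      have t: "0 \<le> t" "t \<le> 1" "l = t * (v $ i - u $ i)"
        using l m(2)[of i] lt[of i] by (auto simp: t_def field_simps)
      have "W = (1 - t) *\<^sub>R A z + t *\<^sub>R A k"
        unfolding W_def k(2)[symmetric] oe by (simp add: vec_eq_iff axis_def t(3) algebra_simps)
      then have W: "W \<in> closed_segment (A z) (A k)" using t by (auto simp: in_segment)
      have "W \<in> side \<Gamma> D2 \<union> \<Gamma>"
      proof (rule edge_part_on_side[OF sep cpt _ _ once[OF e] W])
        show "A z \<in> side \<Gamma> D2" using z by blast
        show "closed_segment (A z) (A k) \<subseteq> cbox a b" using edge_of_imp_subset[OF e] sub by blast
        have "dist (A z) W \<le> 1 / 2 * dist (A z) (A k)" using l m(2)[of i] by (simp add: dW len)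
        then show "A k \<in> side \<Gamma> D2 \<or> (\<exists>D \<in> \<Gamma> \<inter> closed_segment (A z) (A k). dist (A z) W \<le> dist (A z) D)"
          using zk[OF k(1)] by (meson IntD2 order_trans)
      qed
      then show ?thesis by (simp add: W_def)
    qed
    show thesis if "ball Y (3 / 1000 * l) \<subseteq> T \<inter> side \<Gamma> D2" for Y
    proof -
      have "3 / 1000 * l = 3 / 2000 * m" using l(2) by simp
      then show thesis
        using \<open>\<And>Y. ball Y (3 / 2000 * m) \<subseteq> T \<inter> side \<Gamma> D2 \<Longrightarrow> thesis\<close>[of Y] that by metis
    qed
  qed
qed

lemma covered_element_centroid_mem:
  assumes "covered_element \<Gamma> T A T1 T2 P Q R" "convex T"
  shows "centroid P Q R \<in> T"
proof -
  have "{P, Q, R} \<subseteq> edge_points \<Gamma> T"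
    using assms(1) unfolding covered_element_def type_III_def by auto
  then have PQR: "P \<in> T" "Q \<in> T" "R \<in> T"
    using edge_of_imp_subset unfolding edge_points_def by blast+
  have "(2 / 3) *\<^sub>R ((1 / 2) *\<^sub>R P + (1 / 2) *\<^sub>R Q) + (1 / 3) *\<^sub>R R \<in> T"
    by (intro convexD[OF assms(2)] PQR) auto
  then show ?thesis by (simp add: centroid_def scaleR_add_right)
qed

theorem lemma4p3:
  fixes \<sigma> :: real
  shows "\<exists>C>0. \<forall>a b \<Gamma> \<Omega>m \<Omega>p \<T> \<beta>m \<beta>p T A \<Omega>1 \<Omega>2 P Q R n.
    interface_mesh a b \<Gamma> \<Omega>m \<Omega>p \<T> \<longrightarrow> shape_regular \<sigma> \<T> \<longrightarrow>
    0 < \<beta>m \<longrightarrow> \<beta>m \<le> \<beta>p \<longrightarrow>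
    T \<in> \<T> \<longrightarrow> interface_element \<Gamma> \<Omega>m \<Omega>p T \<longrightarrow>
    vertex_labelling T A \<longrightarrow>
    (\<Omega>1, \<Omega>2) \<in> {(\<Omega>m, \<Omega>p), (\<Omega>p, \<Omega>m)} \<longrightarrow>
    (let T1 = T \<inter> side \<Gamma> \<Omega>1; T2 = T \<inter> side \<Gamma> \<Omega>2; F = centroid P Q R in
      A 1 \<in> T1 \<longrightarrow> A 8 \<in> T2 \<longrightarrow>
      covered_element \<Gamma> T A T1 T2 P Q R \<longrightarrow> unit_normal_to_plane P Q R n \<longrightarrow>
      (\<forall>j\<in>{0, 1}. \<forall>p\<in>Q1.
         H_seminorm j T2 (ext_op \<beta>m \<beta>p F n p) \<le> C * H_seminorm j T2 p \<and>
         H_seminorm j T2 (ext_op_inv \<beta>m \<beta>p F n p) \<le> C * (\<beta>p / \<beta>m) * H_seminorm j T2 p))"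
proof -
  define M where "M = 8000 / 3 * max 1 \<sigma>"
  define E where "E = 72 * (64 * (M + 3) ^ 6) * (M ^ 5 + M ^ 3)"
  define C where "C = sqrt (2 + E)"
  have M0: "0 \<le> M" by (simp add: M_def)
  then have E0: "0 \<le> E" by (simp add: E_def)
  have main: "H_seminorm j T2 (ext_op \<beta>m \<beta>p F n p) \<le> C * H_seminorm j T2 p \<and>
         H_seminorm j T2 (ext_op_inv \<beta>m \<beta>p F n p) \<le> C * (\<beta>p / \<beta>m) * H_seminorm j T2 p"
    if mesh: "interface_mesh a b \<Gamma> \<Omega>m \<Omega>p \<T>" and reg: "shape_regular \<sigma> \<T>"
      and \<beta>: "0 < \<beta>m" "\<beta>m \<le> \<beta>p" and T: "T \<in> \<T>" and lab: "vertex_labelling T A"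
      and \<Omega>: "(\<Omega>1, \<Omega>2) \<in> {(\<Omega>m, \<Omega>p), (\<Omega>p, \<Omega>m)}"
      and T2: "T2 = T \<inter> side \<Gamma> \<Omega>2" and F: "F = centroid P Q R"
      and cov: "covered_element \<Gamma> T A T1 T2 P Q R" and n: "unit_normal_to_plane P Q R n"
      and j: "j \<in> {0, 1}" and p: "p \<in> Q1"
    for a b \<Gamma> \<Omega>m \<Omega>p \<T> \<beta>m \<beta>p T A \<Omega>1 \<Omega>2 P Q R n j p F T1 T2
  proof -
    have sep0: "separates \<Gamma> (box a b) \<Omega>m \<Omega>p" and cm: "cartesian_mesh a b \<T>"
      and surf: "closed_C2_surface \<Gamma>"
      using mesh by (simp_all add: interface_mesh_def)
    have sep: "separates \<Gamma> (box a b) \<Omega>1 \<Omega>2" using sep0 separates_swap[OF sep0] \<Omega> by auto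
    obtain u v where uv: "T = cbox u v" "\<And>i. u $ i < v $ i" "T \<subseteq> cbox a b"
      using mesh_cell[OF cm T] by blast
    define m where "m = Min (range (\<lambda>i. v $ i - u $ i))"
    have mle: "m \<le> v $ i - u $ i" for i by (simp add: m_def)
    have "m \<in> range (\<lambda>i. v $ i - u $ i)" unfolding m_def by (rule Min_in) auto
    then obtain i0 where i0: "m = v $ i0 - u $ i0" by blast
    have m0: "0 < m" using uv(2)[of i0] by (simp add: i0)
    obtain Y where Y: "ball Y (3 / 2000 * m) \<subseteq> T2"
      using covered_element_contains_ball[OF mesh T uv lab sep cov[unfolded T2] m0 mle]
      unfolding T2 by blast
    define h where "h = 3 / 8000 * m"
    have h: "0 < h" "ball Y (4 * h) \<subseteq> T2" using m0 Y by (simp_all add: h_def)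
    have M: "v $ i - u $ i \<le> M * h" for i
    proof -
      have "v $ i - u $ i \<le> \<sigma> * m"
        using reg T cell_edge_lengths[of u v, OF uv(2)] unfolding shape_regular_def uv(1) i0 by blast
      also have "\<dots> \<le> max 1 \<sigma> * m" using m0 by (intro mult_right_mono) auto
      finally show ?thesis by (simp add: M_def h_def mult.commute)
    qed
    have "closed \<Gamma>" using surf by (simp add: closed_C2_surface_def compact_imp_closed)
    then have meas: "T2 \<in> sets borel"
      unfolding T2 uv(1) side_def by (intro sets.Int sets.Diff borel_closed closed_cbox closed_closure)
    have FT: "F \<in> cbox u v"
      using covered_element_centroid_mem[OF cov] unfolding F uv(1) by simp
    have n1: "norm n = 1" using n by (simp add: unit_normal_to_plane_def)
    have Hnn: "0 \<le> H_seminorm_sq j T2 p"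
      using j by (auto simp: set_lebesgue_integral_def intro!: sum_nonneg integral_nonneg)
    have bound: "H_seminorm j T2 (\<lambda>X. p X + c * (grad p F \<bullet> n) * ((X - F) \<bullet> n)) \<le> C * k * H_seminorm j T2 p"
      if c: "\<bar>c\<bar> \<le> k" "1 \<le> k" for c k
    proof -
      have sq: "c\<^sup>2 \<le> k\<^sup>2" "1 \<le> k\<^sup>2"
        using c power_mono[of "\<bar>c\<bar>" k 2] by (auto simp: one_le_power)
      have "2 + c\<^sup>2 * E \<le> 2 * k\<^sup>2 + k\<^sup>2 * E"
        using sq E0 by (intro add_mono mult_right_mono) auto
      then have ck: "2 + c\<^sup>2 * E \<le> (C * k)\<^sup>2"
        using E0 by (simp add: C_def power_mult_distrib algebra_simps)
      have "H_seminorm_sq j T2 (\<lambda>X. p X + c * (grad p F \<bullet> n) * ((X - F) \<bullet> n))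
          \<le> (2 + c\<^sup>2 * E) * H_seminorm_sq j T2 p"
        unfolding E_def using T2 uv(1)
        by (intro extension_bound_sq[OF p meas _ h M FT n1 j]) auto
      also have "\<dots> \<le> (C * k)\<^sup>2 * H_seminorm_sq j T2 p" using ck Hnn by (rule mult_right_mono)
      finally have "sqrt (H_seminorm_sq j T2 (\<lambda>X. p X + c * (grad p F \<bullet> n) * ((X - F) \<bullet> n)))
          \<le> sqrt ((C * k)\<^sup>2 * H_seminorm_sq j T2 p)" by (rule real_sqrt_le_mono)
      also have "\<dots> = C * k * sqrt (H_seminorm_sq j T2 p)"
        using E0 c by (simp add: real_sqrt_mult C_def)
      finally show ?thesis by (simp add: H_seminorm_def)
    qed
    have "\<bar>\<beta>m / \<beta>p - 1\<bar> \<le> 1" using \<beta> by (auto simp: field_simps abs_if)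
    moreover have "\<bar>\<beta>p / \<beta>m - 1\<bar> \<le> \<beta>p / \<beta>m" "1 \<le> \<beta>p / \<beta>m" using \<beta> by (auto simp: field_simps abs_if)
    ultimately show ?thesis
      unfolding ext_op_def ext_op_inv_def using bound[of "\<beta>m / \<beta>p - 1" 1] bound[of "\<beta>p / \<beta>m - 1" "\<beta>p / \<beta>m"]
      by simp
  qed
  have "0 < C" using E0 by (simp add: C_def)
  then show ?thesis
    unfolding Let_def
    by (intro exI[of _ C] conjI allI impI ballI)
       (assumption | rule main[THEN conjunct1, OF _ _ _ _ _ _ _ refl refl]
          main[THEN conjunct2, OF _ _ _ _ _ _ _ refl refl])+
qed

end
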